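(* The Thomson heptagon is nonlinearly stable: for $n=7$ point vortices of identical vorticity $\kappa\neq0$ in the Euclidean plane and any $r_0>0$, the relative equilibrium through the regular heptagon $z_j=r_0e^{2\pi\mathrm{i}j/7}$ ($j=1,\dots,7$) is Lyapunov-stable modulo rotations.
   Context: The planar dynamics of $n$ point vortices of identical vorticity $\kappa$ at positions $z_j=x_j+\mathrm{i}y_j\in\mathbb{C}$ takes place on $\mathbb{C}^n$ minus the diagonals $\{z_i=z_j\}$, and is the Hamiltonian system with symplectic form $\sum_j 2\kappa\,dx_j\wedge dy_j$ and Hamiltonian $H(z_1,\dots,z_n)=-\frac{\kappa^2}{4\pi}\sum_{i<j}\log|z_i-z_j|^2$. The regular $n$-gon centred at the origin is a relative equilibrium: it rotates rigidly about the origin. Lyapunov stability modulo rotations means: for every neighbourhood $V$ of the trajectory that is invariant under simultaneous rotation of all vortices about the origin, there is a rotation-invariant neighbourhood $U\subseteq V$ of the trajectory such that every trajectory starting in $U$ remains in $V$ for all time. *)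

theory Defs
  imports "HOL-Analysis.Analysis"
begin

definition configurations :: "(complex ^ 'n) set" where
  "configurations = {z. \<forall>i j. i \<noteq> j \<longrightarrow> z $ i \<noteq> z $ j}"

definition vortex_symplectic :: "real \<Rightarrow> complex ^ 'n \<Rightarrow> complex ^ 'n \<Rightarrow> real" where
  "vortex_symplectic \<kappa> u v =
     (\<Sum>j\<in>UNIV. 2 * \<kappa> * (Re (u $ j) * Im (v $ j) - Im (u $ j) * Re (v $ j)))"

definition vortex_hamiltonian :: "real \<Rightarrow> complex ^ ('n :: {finite, linorder}) \<Rightarrow> real" where
  "vortex_hamiltonian \<kappa> z =
     - (\<kappa>\<^sup>2 / (4 * pi)) * (\<Sum>(i, j)\<in>{(i, j). i < j}. ln ((cmod (z $ i - z $ j))\<^sup>2))"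

text \<open>
  Sign convention: the Hamiltonian vector field \<open>X\<close> satisfies \<open>\<omega>(X, v) = dH(v)\<close> for all \<open>v\<close>.
  The opposite convention only reverses time, and stability below concerns both time directions.
\<close>

definition integral_curve ::
  "real \<Rightarrow> real set \<Rightarrow> (real \<Rightarrow> complex ^ ('n :: {finite, linorder})) \<Rightarrow> bool" where
  "integral_curve \<kappa> I \<gamma> \<longleftrightarrow>
     open I \<and> is_interval I \<and>
     (\<forall>t\<in>I. \<gamma> t \<in> configurations \<and>
       (\<exists>X. (\<gamma> has_vector_derivative X) (at t) \<and>
            (vortex_hamiltonian \<kappa> has_derivative vortex_symplectic \<kappa> X) (at (\<gamma> t))))"

text \<open>
  Trajectories are the maximal integral curves. A curve is given by its domain \<open>I\<close> and a
  total function whose values outside \<open>I\<close> are irrelevant.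
\<close>

definition trajectory ::
  "real \<Rightarrow> real set \<Rightarrow> (real \<Rightarrow> complex ^ ('n :: {finite, linorder})) \<Rightarrow> bool" where
  "trajectory \<kappa> I \<gamma> \<longleftrightarrow>
     integral_curve \<kappa> I \<gamma> \<and>
     (\<forall>J \<delta>. integral_curve \<kappa> J \<delta> \<and> I \<subseteq> J \<and> (\<forall>t\<in>I. \<delta> t = \<gamma> t) \<longrightarrow> J = I)"

definition rotate_config :: "real \<Rightarrow> complex ^ 'n \<Rightarrow> complex ^ 'n" where
  "rotate_config \<theta> z = (\<chi> j. cis \<theta> * z $ j)"

definition relative_equilibrium ::
  "real \<Rightarrow> (real \<Rightarrow> complex ^ ('n :: {finite, linorder})) \<Rightarrow> bool" where
  "relative_equilibrium \<kappa> \<gamma> \<longleftrightarrow>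
     trajectory \<kappa> UNIV \<gamma> \<and> (\<exists>\<Omega>. \<forall>t. \<gamma> t = rotate_config (\<Omega> * t) (\<gamma> 0))"

definition invariant_neighbourhood :: "(complex ^ 'n) set \<Rightarrow> (complex ^ 'n) set \<Rightarrow> bool" where
  "invariant_neighbourhood T V \<longleftrightarrow>
     V \<subseteq> configurations \<and> T \<subseteq> interior V \<and> (\<forall>\<theta>. \<forall>z\<in>V. rotate_config \<theta> z \<in> V)"

text \<open>
  That a trajectory remains in \<open>V\<close> for all time includes that it is defined for all time.
\<close>

definition stable_modulo_rotations ::
  "real \<Rightarrow> (real \<Rightarrow> complex ^ ('n :: {finite, linorder})) \<Rightarrow> bool" where
  "stable_modulo_rotations \<kappa> \<gamma> \<longleftrightarrow>
     (\<forall>V. invariant_neighbourhood (range \<gamma>) V \<longrightarrow>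
       (\<exists>U \<subseteq> V. invariant_neighbourhood (range \<gamma>) U \<and>
         (\<forall>I \<delta>. trajectory \<kappa> I \<delta> \<and> 0 \<in> I \<and> \<delta> 0 \<in> U \<longrightarrow> I = UNIV \<and> (\<forall>t. \<delta> t \<in> V))))"

text \<open>
  Indices \<open>1, \<dots>, 7\<close> are read in the seven-element type \<open>7\<close> of integers modulo 7 through
  \<open>of_nat\<close>; the index 7 is the element 0. The order on that type serves only to list each
  unordered pair once in the Hamiltonian.
\<close>

definition regular_heptagon :: "real \<Rightarrow> complex ^ 7 \<Rightarrow> bool" where
  "regular_heptagon r z \<longleftrightarrow>
     (\<forall>j\<in>{1..7::nat}. z $ of_nat j = complex_of_real r * exp (2 * pi * \<i> * of_nat j / 7))"

end

theory Submission
  imports Defs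
begin

text \<open>
The Hamiltonian and the moment of inertia \<open>|z|\<^sup>2\<close> are both conserved, hence so is the combination
\<open>\<Lambda> z = (\<Sum>i<j. ln |z\<^sub>i - z\<^sub>j|\<^sup>2) - (3 / r\<^sup>2) |z|\<^sup>2\<close>, for which the heptagon of radius \<open>r\<close> is a critical
point. If \<open>\<Lambda>\<close> has a strict local maximum there up to rotation, then Dirichlet's argument
(\<open>strict_local_max_imp_stable\<close>) gives stability: on the boundary of a small tube around the circle of
rotated heptagons \<open>\<Lambda>\<close> stays below some level \<open>M\<close> less than the maximum, so a trajectory that starts
in the tube with \<open>\<Lambda> > M\<close> can never cross the boundary. Such a trajectory keeps its vortices at a distance from
each other that is bounded below, where the vector field is bounded and Lipschitz, so it exists for
all time (\<open>trajectory_in_separated_is_global\<close>).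

The difficulty is the maximum, because the heptagon is the borderline case of Thomson's polygons: the
second variation of \<open>\<Lambda>\<close> is negative semidefinite, but besides rotation it has a two-dimensional
kernel, so that terms of fourth order decide. Write a configuration as
\<open>z\<^sub>j = r (x + \<Sum>m<7. b\<^sub>m x\<^sup>m)\<close>, where \<open>x\<close> is the corresponding seventh root of unity. Then
\<open>z\<^sub>i - z\<^sub>j = r (x - y) (1 + h(x, y))\<close> with the polynomial \<open>h(x, y) = \<Sum>m<7. b\<^sub>m (x\<^sup>m - y\<^sup>m) / (x - y)\<close>,
and the change of \<open>\<Lambda>\<close> is
\<open>Re (\<Sum>x\<noteq>y. Ln (1 + h(x, y))) - 21 (2 Re b\<^sub>1 + \<Sum>m. |b\<^sub>m|\<^sup>2)\<close>. Sums over pairs of roots of a homogeneous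
polynomial vanish unless 7 divides its degree, so each Taylor coefficient is a short explicit sum.
The quadratic part is
\<open>- 21 (Re (b\<^sub>1\<^sup>2) + \<Sum>m. |b\<^sub>m|\<^sup>2) + 28 Re b\<^sub>3 b\<^sub>6 + 42 Re b\<^sub>4 b\<^sub>5\<close>; apart from the rotation mode \<open>Im b\<^sub>1\<close> its kernel
is \<open>b\<^sub>4 = q, b\<^sub>5 = cnj q\<close>.

Give \<open>q\<close> weight 1 and all other modes weight 2; then the terms of weight at most 4 decide. The kernel
contributes no cubic term, the quartic term \<open>- 357 |q|\<^sup>4\<close>, and the couplings
\<open>- 126 Re (q\<^sup>2 b\<^sub>2) - 84 |q|\<^sup>2 Re b\<^sub>1\<close>. Completing squares against \<open>- 21 |b\<^sub>2|\<^sup>2 - 42 (Re b\<^sub>1)\<^sup>2\<close> costs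
\<open>189 |q|\<^sup>4 + 42 |q|\<^sup>4\<close>, which leaves \<open>- 126 |q|\<^sup>4 < 0\<close>. The lemma \<open>heptagon_log_estimate\<close> carries this
out with explicit error bounds.
\<close>

section \<open>Ordinary differential equations with uniform bounds\<close>

text \<open>
Clamping the upper limit of integration turns the Picard integral into a bounded continuous function
on the whole line, so that the fixed point can be sought in the space of such functions. Subtracting
the integral up to \<open>t0\<close> makes the primitive two-sided without signed integrals; this costs
the factor 3 instead of 1 in the bound.
\<close>

lemma clamped_primitive:
  fixes g :: "real \<Rightarrow> 'a::banach" and t0 h :: real
  defines "J \<equiv> \<lambda>t. integral {t0 - h..max (t0 - h) (min (t0 + h) t)} g - integral {t0 - h..t0} g"
  assumes "h > 0" and cont: "continuous_on UNIV g" and bound: "\<And>t. norm (g t) \<le> B"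
  shows "continuous_on UNIV J" and "norm (J t) \<le> 3 * h * B"
    and "\<And>t. t \<in> ball t0 h \<Longrightarrow> (J has_vector_derivative g t) (at t)"
proof -
  let ?a = "t0 - h" and ?b = "t0 + h"
  let ?c = "\<lambda>t. max ?a (min ?b t)"
  have contg: "continuous_on S g" for S
    using cont continuous_on_subset by blast
  have deriv: "((\<lambda>u. integral {?a..u} g) has_vector_derivative g u) (at u within {?a..?b})"
    if "u \<in> {?a..?b}" for u
    using integral_has_vector_derivative[OF contg that] .
  have "continuous_on {?a..?b} (\<lambda>u. integral {?a..u} g)"
    unfolding continuous_on_eq_continuous_within
    using has_vector_derivative_continuous[OF deriv] by blast
  then have "continuous_on UNIV (\<lambda>t. integral {?a..?c t} g)"
  proof (rule continuous_on_compose2)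
    show "continuous_on UNIV ?c" by (intro continuous_intros)
    show "range ?c \<subseteq> {?a..?b}" using \<open>h > 0\<close> by auto
  qed
  then show "continuous_on UNIV J"
    unfolding J_def by (intro continuous_intros)
  have "B \<ge> 0"
    using bound[of 0] norm_ge_zero order_trans by blast
  have "norm (integral {?a..u} g) \<le> B * (u - ?a)" if "u \<ge> ?a" for u
    using that by (intro integral_bound contg bound) auto
  from this[of "?c t"] this[of t0]
  have "norm (J t) \<le> B * (?c t - ?a) + B * (t0 - ?a)"
    unfolding J_def using \<open>h > 0\<close> by (intro order_trans[OF norm_triangle_ineq4] add_mono) auto
  also have "\<dots> \<le> B * (2 * h) + B * h"
    using \<open>B \<ge> 0\<close> \<open>h > 0\<close> by (intro add_mono mult_left_mono) auto
  finally show "norm (J t) \<le> 3 * h * B"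
    by (simp add: algebra_simps)
  fix t assume t: "t \<in> ball t0 h"
  then have t': "t \<in> {?a<..<?b}"
    by (auto simp: dist_real_def)
  have "((\<lambda>u. integral {?a..u} g) has_vector_derivative g t) (at t within {?a<..<?b})"
    using deriv[of t] t' by (intro has_vector_derivative_within_subset[OF deriv]) auto
  then have "((\<lambda>u. integral {?a..u} g) has_vector_derivative g t) (at t)"
    using t' at_within_open[of t "{?a<..<?b}"] by simp
  then have "((\<lambda>u. integral {?a..u} g - integral {?a..t0} g) has_vector_derivative g t) (at t)"
    by (auto intro!: derivative_eq_intros)
  then show "(J has_vector_derivative g t) (at t)"
  proof (rule has_vector_derivative_transform_within_open[OF _ open_greaterThanLessThan t'])
    fix u assume "u \<in> {?a<..<?b}"
    then have "?c u = u" by simp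
    then show "integral {?a..u} g - integral {?a..t0} g = J u" by (simp only: J_def)
  qed
qed

text \<open>
What matters for the extension of solutions is that the length of the time interval depends on
the bounds \<open>M\<close>, \<open>L\<close> and \<open>r\<close> only, not on the initial point.
\<close>

lemma picard_local_existence:
  fixes f :: "'a::euclidean_space \<Rightarrow> 'a"
  assumes "h > 0" and "r \<ge> 0" and "L \<ge> 0" and lip: "L-lipschitz_on (cball x0 r) f"
    and bound: "\<And>x. x \<in> cball x0 r \<Longrightarrow> norm (f x) \<le> M"
    and hM: "3 * h * M \<le> r" and hL: "3 * h * L < 1"
  obtains y where "y t0 = x0" and "\<And>t. y t \<in> cball x0 r"
    and "\<And>t. t \<in> ball t0 h \<Longrightarrow> (y has_vector_derivative f (y t)) (at t)"
proof -
  define J where "J g t = integral {t0 - h..max (t0 - h) (min (t0 + h) t)} g - integral {t0 - h..t0} g"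
    for g :: "real \<Rightarrow> 'a" and t
  define S :: "(real \<Rightarrow>\<^sub>C 'a) set" where "S = PiC UNIV (\<lambda>_. cball x0 r)"
  define T where "T x = Bcontfun (\<lambda>t. x0 + J (\<lambda>s. f (apply_bcontfun x s)) t)" for x :: "real \<Rightarrow>\<^sub>C 'a"
  have mem_S: "x \<in> S \<longleftrightarrow> (\<forall>t. apply_bcontfun x t \<in> cball x0 r)" for x
    unfolding S_def mem_PiC_iff by (auto simp: Pi_def)
  have fx_cont: "continuous_on UNIV (\<lambda>s. f (apply_bcontfun x s))" if "x \<in> S" for x
  proof (rule continuous_on_compose2[OF lipschitz_on_continuous_on[OF lip]])
    show "continuous_on UNIV (apply_bcontfun x)" by simp
    show "range (apply_bcontfun x) \<subseteq> cball x0 r" using that mem_S by blast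
  qed
  have fx_bound: "norm (f (apply_bcontfun x s)) \<le> M" if "x \<in> S" for x s
    using that bound by (auto simp: mem_S)
  have J_bound: "norm (J (\<lambda>s. f (apply_bcontfun x s)) t) \<le> 3 * h * M" if "x \<in> S" for x t
    unfolding J_def using clamped_primitive(2)[OF \<open>h > 0\<close> fx_cont[OF that] fx_bound[OF that]] .
  have apply_T: "apply_bcontfun (T x) t = x0 + J (\<lambda>s. f (apply_bcontfun x s)) t" if "x \<in> S" for x t
  proof -
    have "continuous_on UNIV (J (\<lambda>s. f (apply_bcontfun x s)))"
      unfolding J_def using clamped_primitive(1)[OF \<open>h > 0\<close> fx_cont[OF that] fx_bound[OF that]] .
    moreover have "norm (x0 + J (\<lambda>s. f (apply_bcontfun x s)) t) \<le> norm x0 + 3 * h * M" for t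
      by (rule order_trans[OF norm_triangle_ineq add_left_mono[OF J_bound[OF that]]])
    ultimately have "(\<lambda>t. x0 + J (\<lambda>s. f (apply_bcontfun x s)) t) \<in> bcontfun"
      by (intro bcontfun_normI continuous_intros) auto
    then show ?thesis
      unfolding T_def by (simp add: Bcontfun_inverse)
  qed
  \<comment> \<open>The Picard operator contracts the bounded continuous functions with values in the ball.\<close>
  have "\<exists>!x\<in>S. T x = x"
  proof (rule Banach_fix)
    show "complete S"
      unfolding S_def by (simp add: complete_eq_closed closed_PiC)
    have "const_bcontfun x0 \<in> S"
      using \<open>r \<ge> 0\<close> by (simp add: mem_S const_bcontfun.rep_eq)
    then show "S \<noteq> {}" by blast
    show "0 \<le> 3 * h * L" "3 * h * L < 1"
      using assms by auto
    have "T x \<in> S" if "x \<in> S" for x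
      unfolding mem_S using apply_T[OF that] order_trans[OF J_bound[OF that] hM] by (simp add: dist_norm)
    then show "T ` S \<subseteq> S" by blast
    fix x y assume xy: "x \<in> S" "y \<in> S"
    show "dist (T x) (T y) \<le> 3 * h * L * dist x y"
    proof (rule dist_bound)
      fix t
      let ?g = "\<lambda>s. f (apply_bcontfun x s) - f (apply_bcontfun y s)"
      have le: "norm (?g s) \<le> L * dist x y" for s
      proof -
        have "norm (?g s) \<le> L * dist (apply_bcontfun x s) (apply_bcontfun y s)"
          using lipschitz_onD[OF lip] xy by (simp add: mem_S dist_norm)
        also have "\<dots> \<le> L * dist x y"
          using \<open>L \<ge> 0\<close> dist_bounded by (intro mult_left_mono)
        finally show ?thesis .
      qed
      have "J ?g t = J (\<lambda>s. f (apply_bcontfun x s)) t - J (\<lambda>s. f (apply_bcontfun y s)) t"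
        unfolding J_def using fx_cont xy
        by (subst (1 2) integral_diff)
          (auto intro!: integrable_continuous_real intro: continuous_on_subset)
      then have "dist (T x t) (T y t) = norm (J ?g t)"
        by (simp add: apply_T xy dist_norm)
      also have "\<dots> \<le> 3 * h * (L * dist x y)"
        unfolding J_def using fx_cont xy le
        by (intro clamped_primitive(2) \<open>h > 0\<close>) (auto intro!: continuous_intros)
      finally show "dist (T x t) (T y t) \<le> 3 * h * L * dist x y"
        by simp
    qed
  qed
  then obtain x where x: "x \<in> S" "T x = x" by blast
  have eq: "apply_bcontfun x t = x0 + J (\<lambda>s. f (apply_bcontfun x s)) t" for t
    using apply_T[OF x(1), of t] unfolding x(2) .
  show ?thesis
  proof
    show "apply_bcontfun x t0 = x0"
      using eq[of t0] \<open>h > 0\<close> by (simp add: J_def)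
    show "apply_bcontfun x t \<in> cball x0 r" for t
      using x(1) by (simp add: mem_S)
    fix t assume "t \<in> ball t0 h"
    then have "(J (\<lambda>s. f (apply_bcontfun x s)) has_vector_derivative f (apply_bcontfun x t)) (at t)"
      unfolding J_def using clamped_primitive(3)[OF \<open>h > 0\<close> fx_cont[OF x(1)] fx_bound[OF x(1)]] by blast
    then have "((\<lambda>t. x0 + J (\<lambda>s. f (apply_bcontfun x s)) t) has_vector_derivative f (apply_bcontfun x t)) (at t)"
      by (auto intro!: derivative_eq_intros)
    then show "(apply_bcontfun x has_vector_derivative f (apply_bcontfun x t)) (at t)"
      unfolding eq[abs_def, symmetric] .
  qed
qed

text \<open>
With \<open>g = |x - y|\<^sup>2\<close>, the Lipschitz condition gives \<open>|g'| \<le> 2 L g\<close>. Hence \<open>g t exp (- 2 L t)\<close> decreases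
to the right of \<open>t0\<close>, and \<open>g t exp (2 L t)\<close> increases to the left of it; both vanish at \<open>t0\<close>.
\<close>

lemma solution_unique:
  fixes f :: "'a::euclidean_space \<Rightarrow> 'a"
  assumes lip: "L-lipschitz_on D f" and "is_interval I" "t0 \<in> I" "t \<in> I"
    and x: "\<And>t. t \<in> I \<Longrightarrow> x t \<in> D \<and> (x has_vector_derivative f (x t)) (at t)"
    and y: "\<And>t. t \<in> I \<Longrightarrow> y t \<in> D \<and> (y has_vector_derivative f (y t)) (at t)"
    and "x t0 = y t0"
  shows "x t = y t"
proof -
  define g where "g s = (x s - y s) \<bullet> (x s - y s)" for s
  have g0: "g t0 = 0" "\<And>s. g s \<ge> 0"
    using assms by (auto simp: g_def)
  define g' where "g' s = 2 * ((x s - y s) \<bullet> (f (x s) - f (y s)))" for s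
  have g: "(g has_real_derivative g' s) (at s)" if "s \<in> I" for s
  proof -
    have "((\<lambda>s. x s - y s) has_vector_derivative f (x s) - f (y s)) (at s)"
      using x y that by (auto intro!: derivative_intros)
    then have d: "((\<lambda>s. x s - y s) has_derivative (\<lambda>u. u *\<^sub>R (f (x s) - f (y s)))) (at s)"
      by (simp add: has_vector_derivative_def)
    show ?thesis
      unfolding g_def g'_def has_field_derivative_def
      by (rule has_derivative_eq_rhs[OF has_derivative_inner[OF d d]])
        (auto simp: inner_commute)
  qed
  have g': "\<bar>g' s\<bar> \<le> 2 * L * g s" if "s \<in> I" for s
  proof -
    have "\<bar>(x s - y s) \<bullet> (f (x s) - f (y s))\<bar> \<le> norm (x s - y s) * norm (f (x s) - f (y s))"
      by (rule Cauchy_Schwarz_ineq2)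
    also have "\<dots> \<le> norm (x s - y s) * (L * norm (x s - y s))"
      using lipschitz_onD[OF lip, of "x s" "y s"] x y that by (intro mult_left_mono) (auto simp: dist_norm)
    also have "\<dots> = L * g s"
      by (simp add: g_def power2_norm_eq_inner[symmetric] power2_eq_square)
    finally show ?thesis
      by (simp add: g'_def abs_mult)
  qed
  have between: "s \<in> I" if "s \<in> closed_segment t0 t" for s
    using that assms(2-4) by (meson closed_segment_subset is_interval_convex subsetD)
  have "g t \<le> 0"
  proof (cases "t0 \<le> t")
    case True
    have "g t * exp (- 2 * L * t) \<le> g t0 * exp (- 2 * L * t0)"
    proof (rule DERIV_nonpos_imp_nonincreasing[OF True])
      fix s assume "t0 \<le> s" "s \<le> t"
      then have s: "s \<in> I" using between True by (simp add: closed_segment_eq_real_ivl)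
      have "((\<lambda>t. g t * exp (- 2 * L * t)) has_real_derivative (g' s - 2 * L * g s) * exp (- 2 * L * s)) (at s)"
        by (auto intro!: derivative_eq_intros g[OF s] simp: algebra_simps)
      moreover have "(g' s - 2 * L * g s) * exp (- 2 * L * s) \<le> 0"
        using g'[OF s] by (simp add: mult_nonpos_nonneg)
      ultimately show "\<exists>y. ((\<lambda>t. g t * exp (- 2 * L * t)) has_real_derivative y) (at s) \<and> y \<le> 0" by blast
    qed
    then show ?thesis using g0 by (simp add: mult_le_0_iff)
  next
    case False
    have "g t * exp (2 * L * t) \<le> g t0 * exp (2 * L * t0)"
    proof (rule DERIV_nonneg_imp_nondecreasing[of t t0 "\<lambda>t. g t * exp (2 * L * t)"])
      show "t \<le> t0" using False by simp
      fix s assume "t \<le> s" "s \<le> t0"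
      then have s: "s \<in> I" using between False by (simp add: closed_segment_eq_real_ivl)
      have "((\<lambda>t. g t * exp (2 * L * t)) has_real_derivative (g' s + 2 * L * g s) * exp (2 * L * s)) (at s)"
        by (auto intro!: derivative_eq_intros g[OF s] simp: algebra_simps)
      moreover have "(g' s + 2 * L * g s) * exp (2 * L * s) \<ge> 0"
        using g'[OF s] by simp
      ultimately show "\<exists>y. ((\<lambda>t. g t * exp (2 * L * t)) has_real_derivative y) (at s) \<and> y \<ge> 0" by blast
    qed
    then show ?thesis using g0 by (simp add: mult_le_0_iff)
  qed
  then show ?thesis
    using g0(2)[of t] antisym[of "g t" 0] by (simp add: g_def)
qed

text \<open>
If every interval of the uniform length given by \<open>picard_local_existence\<close> around a time of \<open>I\<close>
stayed inside \<open>I\<close>, then \<open>I\<close> would be closed as well as open. So some local solution reaches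
beyond \<open>I\<close>, and by uniqueness it can be glued to the given one.
\<close>

lemma solution_extension:
  fixes f :: "'a::euclidean_space \<Rightarrow> 'a"
  assumes lip: "L-lipschitz_on D f" and bound: "\<And>x. x \<in> D \<Longrightarrow> norm (f x) \<le> M" and "r > 0"
    and I: "open I" "is_interval I" "I \<noteq> {}" "I \<noteq> UNIV"
    and x: "\<And>t. t \<in> I \<Longrightarrow> cball (x t) r \<subseteq> D \<and> (x has_vector_derivative f (x t)) (at t)"
  obtains J y where "open J" "is_interval J" "I \<subset> J" "\<And>t. t \<in> I \<Longrightarrow> y t = x t"
    "\<And>t. t \<in> J \<Longrightarrow> y t \<in> D \<and> (y has_vector_derivative f (y t)) (at t)"
proof -
  have xD: "x t \<in> D" if "t \<in> I" for t
    using x[OF that] \<open>r > 0\<close> by auto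
  have "L \<ge> 0" using lip lipschitz_on_nonneg by blast
  define N where "N = 1 + \<bar>M\<bar> + L"
  have N: "N > 0" "M \<le> N" "L < N" using \<open>L \<ge> 0\<close> by (auto simp: N_def)
  define h where "h = min 1 r / (3 * N)"
  have h: "h > 0" "3 * h * N \<le> r" "3 * h * N \<le> 1"
    using N \<open>r > 0\<close> by (auto simp: h_def)
  have hM: "3 * h * M \<le> r"
    using h N by (meson mult_left_mono order_trans less_imp_le mult_pos_pos zero_less_numeral)
  have "3 * h * L < 3 * h * N" using h N by simp
  then have hL: "3 * h * L < 1" using h by linarith
  obtain t0 where t0: "t0 \<in> I" "\<not> ball t0 h \<subseteq> I"
  proof (rule ccontr)
    assume "\<not> thesis"
    with that have sub: "ball t h \<subseteq> I" if "t \<in> I" for t using that by blast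
    have "closure I \<subseteq> I"
    proof
      fix t assume "t \<in> closure I"
      then obtain s where "s \<in> I" "dist s t < h" using h closure_approachable by blast
      then show "t \<in> I" using sub[of s] by auto
    qed
    then have "closed I" by (simp add: closure_subset_eq)
    with I show False using clopen[of I] by auto
  qed
  obtain y where y0: "y t0 = x t0" and yr: "\<And>t. y t \<in> cball (x t0) r"
    and y: "\<And>t. t \<in> ball t0 h \<Longrightarrow> (y has_vector_derivative f (y t)) (at t)"
    using picard_local_existence[OF h(1) less_imp_le[OF \<open>r > 0\<close>] \<open>L \<ge> 0\<close> lipschitz_on_subset[OF lip] bound hM hL, of "x t0" t0]
      x[OF t0(1)] by blast
  have yD: "y t \<in> D" for t
    using yr x[OF t0(1)] by blast
  have agree: "x t = y t" if "t \<in> I" "t \<in> ball t0 h" for t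
    by (rule solution_unique[OF lip, of "I \<inter> ball t0 h" t0])
      (use that t0 h(1) x xD y yD y0 I in \<open>auto simp: is_interval_convex_1 intro!: convex_Int\<close>)
  define w where "w t = (if t \<in> I then x t else y t)" for t
  have wI: "w t = x t" if "t \<in> I" for t
    using that by (simp add: w_def)
  have wB: "w t = y t" if "t \<in> ball t0 h" for t
    using that agree by (auto simp: w_def)
  show ?thesis
  proof
    show "open (I \<union> ball t0 h)" using I by auto
    show "is_interval (I \<union> ball t0 h)"
      unfolding is_interval_connected_1 using I t0 h
      by (intro connected_Un) (auto simp: is_interval_connected_1)
    show "I \<subset> I \<union> ball t0 h" using t0 by auto
    show "w t = x t" if "t \<in> I" for t using wI that .
    fix t assume "t \<in> I \<union> ball t0 h"
    then consider "t \<in> I" | "t \<in> ball t0 h" by blast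
    then show "w t \<in> D \<and> (w has_vector_derivative f (w t)) (at t)"
    proof cases
      case 1
      have "(w has_vector_derivative f (x t)) (at t)"
        by (rule has_vector_derivative_transform_within_open[OF conjunct2[OF x[OF 1]] I(1) 1 wI[symmetric]])
      then show ?thesis using 1 wI xD by simp
    next
      case 2
      have "(w has_vector_derivative f (y t)) (at t)"
        by (rule has_vector_derivative_transform_within_open[OF y[OF 2] open_ball 2 wB[symmetric]])
      then show ?thesis using 2 wB yD by simp
    qed
  qed
qed

section \<open>The vector field of the point vortices\<close>

definition log_distance_sum :: "complex ^ ('n :: {finite, linorder}) \<Rightarrow> real" where
  "log_distance_sum z = (\<Sum>(i, j)\<in>{(i, j). i < j}. ln ((cmod (z $ i - z $ j))\<^sup>2))"

definition inverse_difference_sum :: "complex ^ 'n \<Rightarrow> 'n \<Rightarrow> complex" where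
  "inverse_difference_sum z j = (\<Sum>i\<in>- {j}. 1 / (z $ j - z $ i))"

text \<open>
The Hamiltonian vector field for the sign convention \<open>\<omega>(X, v) = dH(v)\<close>.
\<close>

definition velocity :: "real \<Rightarrow> complex ^ 'n \<Rightarrow> complex ^ 'n" where
  "velocity \<kappa> z = (\<chi> j. \<i> * complex_of_real (\<kappa> / (4 * pi)) * cnj (inverse_difference_sum z j))"

lemma sum_unordered_pairs:
  fixes f :: "'n :: {finite, linorder} \<Rightarrow> 'n \<Rightarrow> real"
  assumes "\<And>i j. f i j = f j i"
  shows "2 * (\<Sum>(i, j)\<in>{(i, j). i < j}. f i j) = (\<Sum>i\<in>UNIV. \<Sum>j\<in>- {i}. f i j)"
proof -
  have "(\<Sum>i\<in>UNIV. \<Sum>j\<in>- {i}. f i j) = (\<Sum>(i, j)\<in>(SIGMA i:UNIV. - {i}). f i j)"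
    by (rule sum.Sigma) auto
  also have "(SIGMA i:UNIV. - {i}) = {(i, j). i < j} \<union> {(i, j). j < (i::'n)}"
    by auto
  also have "(\<Sum>(i, j)\<in>{(i, j). i < j} \<union> {(i, j). j < (i::'n)}. f i j)
    = (\<Sum>(i, j)\<in>{(i, j). i < j}. f i j) + (\<Sum>(i, j)\<in>{(i, j). j < i}. f i j)"
    by (rule sum.union_disjoint) auto
  also have "(\<Sum>(i, j)\<in>{(i, j). j < i}. f i j) = (\<Sum>(i, j)\<in>{(i, j). i < j}. f i j)"
    by (rule sum.reindex_bij_witness[of _ prod.swap prod.swap]) (auto intro: assms)
  finally show ?thesis by simp
qed

lemma sum_off_diagonal_swap:
  fixes f :: "'n :: finite \<Rightarrow> 'n \<Rightarrow> 'a::comm_monoid_add"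
  shows "(\<Sum>i\<in>UNIV. \<Sum>j\<in>- {i}. f i j) = (\<Sum>i\<in>UNIV. \<Sum>j\<in>- {i}. f j i)"
proof -
  have "(\<Sum>i\<in>UNIV. \<Sum>j\<in>- {i}. f i j) = (\<Sum>i\<in>UNIV. \<Sum>j | j \<in> UNIV \<and> j \<noteq> i. f i j)"
    by (intro sum.cong) auto
  also have "\<dots> = (\<Sum>j\<in>UNIV. \<Sum>i | i \<in> UNIV \<and> j \<noteq> i. f i j)"
    by (rule sum.swap_restrict) auto
  also have "\<dots> = (\<Sum>i\<in>UNIV. \<Sum>j\<in>- {i}. f j i)"
    by (intro sum.cong) auto
  finally show ?thesis .
qed

lemma has_derivative_ln_cmod_difference:
  fixes z :: "complex ^ 'n"
  assumes "z $ i \<noteq> z $ j"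
  shows "((\<lambda>z. ln ((cmod (z $ i - z $ j))\<^sup>2)) has_derivative
    (\<lambda>v. 2 * Re ((v $ i - v $ j) / (z $ i - z $ j)))) (at z)"
proof -
  define w where "w = z $ i - z $ j"
  have w: "w \<noteq> 0" using assms by (simp add: w_def)
  have d: "((\<lambda>z. z $ i - z $ j) has_derivative (\<lambda>v. v $ i - v $ j)) (at z)"
    by (intro has_derivative_diff bounded_linear_imp_has_derivative bounded_linear_vec_nth)
  have "((\<lambda>z. (z $ i - z $ j) \<bullet> (z $ i - z $ j)) has_derivative (\<lambda>v. 2 * (w \<bullet> (v $ i - v $ j)))) (at z)"
    by (rule has_derivative_eq_rhs[OF has_derivative_inner[OF d d]]) (auto simp: inner_commute w_def)
  then have "((\<lambda>z. ln ((z $ i - z $ j) \<bullet> (z $ i - z $ j))) has_derivative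
      (\<lambda>v. 2 * (w \<bullet> (v $ i - v $ j)) * inverse (w \<bullet> w))) (at z)"
    using w has_derivative_ln[of "\<lambda>z. (z $ i - z $ j) \<bullet> (z $ i - z $ j)" z _ UNIV]
    by (simp add: w_def[symmetric])
  moreover have "2 * (w \<bullet> v) * inverse (w \<bullet> w) = 2 * Re (v / w)" for v
    by (simp add: inner_complex_def Re_divide power2_eq_square divide_inverse)
       (simp add: algebra_simps)
  ultimately show ?thesis
    by (simp only: power2_norm_eq_inner w_def)
qed

lemma has_derivative_log_distance_sum:
  fixes z :: "complex ^ ('n :: {finite, linorder})"
  assumes "z \<in> configurations"
  shows "(log_distance_sum has_derivative
    (\<lambda>v. 2 * (\<Sum>j\<in>UNIV. Re (v $ j * inverse_difference_sum z j)))) (at z)"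
proof -
  let ?D = "\<lambda>v i j. Re ((v $ i - v $ j) / (z $ i - z $ j))"
  have "((\<lambda>z. \<Sum>p\<in>{(i, j). i < j}. ln ((cmod (z $ fst p - z $ snd p))\<^sup>2)) has_derivative
      (\<lambda>v. \<Sum>p\<in>{(i, j). i < j}. 2 * ?D v (fst p) (snd p))) (at z)"
    using assms by (intro has_derivative_sum has_derivative_ln_cmod_difference)
      (auto simp: configurations_def)
  moreover have "(\<Sum>p\<in>{(i, j). i < j}. 2 * ?D v (fst p) (snd p))
      = 2 * (\<Sum>j\<in>UNIV. Re (v $ j * inverse_difference_sum z j))" for v
  proof -
    have neg: "a / (x - y) = - (a / (y - x))" for a x y :: complex
      by (metis minus_diff_eq minus_divide_right)
    have "(\<Sum>p\<in>{(i, j). i < j}. 2 * ?D v (fst p) (snd p)) = 2 * (\<Sum>(i, j)\<in>{(i, j). i < j}. ?D v i j)"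
      by (simp add: sum_distrib_left case_prod_unfold)
    also have "\<dots> = (\<Sum>i\<in>UNIV. \<Sum>j\<in>- {i}. ?D v i j)"
      by (rule sum_unordered_pairs) (metis minus_diff_eq minus_divide_divide)
    also have "\<dots> = (\<Sum>i\<in>UNIV. \<Sum>j\<in>- {i}. Re (v $ i / (z $ i - z $ j)))
        + (\<Sum>i\<in>UNIV. \<Sum>j\<in>- {i}. Re (v $ j / (z $ j - z $ i)))"
      unfolding sum.distrib[symmetric]
    proof (intro sum.cong refl)
      fix i j
      show "?D v i j = Re (v $ i / (z $ i - z $ j)) + Re (v $ j / (z $ j - z $ i))"
        using neg[of "v $ j" "z $ j" "z $ i"] by (simp add: diff_divide_distrib)
    qed
    also have "\<dots> = 2 * (\<Sum>i\<in>UNIV. \<Sum>j\<in>- {i}. Re (v $ i / (z $ i - z $ j)))"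
      by (simp only: sum_off_diagonal_swap[of "\<lambda>i j. Re (v $ j / (z $ j - z $ i))"] mult_2)
    also have "\<dots> = 2 * (\<Sum>j\<in>UNIV. Re (v $ j * inverse_difference_sum z j))"
      by (simp add: inverse_difference_sum_def sum_distrib_left Re_sum)
    finally show ?thesis .
  qed
  ultimately show ?thesis
    unfolding log_distance_sum_def[abs_def] by (simp add: case_prod_unfold)
qed

lemma vortex_symplectic_eq_Im:
  "vortex_symplectic \<kappa> u v = 2 * \<kappa> * (\<Sum>j\<in>UNIV. Im (cnj (u $ j) * v $ j))"
  by (simp add: vortex_symplectic_def sum_distrib_left)

lemma vortex_hamiltonian_eq: "vortex_hamiltonian \<kappa> z = - (\<kappa>\<^sup>2 / (4 * pi)) * log_distance_sum z"
  by (simp add: vortex_hamiltonian_def log_distance_sum_def)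

lemma has_derivative_vortex_hamiltonian:
  fixes z :: "complex ^ ('n :: {finite, linorder})"
  assumes "z \<in> configurations"
  shows "(vortex_hamiltonian \<kappa> has_derivative vortex_symplectic \<kappa> (velocity \<kappa> z)) (at z)"
proof -
  have "((\<lambda>z. - (\<kappa>\<^sup>2 / (4 * pi)) * log_distance_sum z) has_derivative
     (\<lambda>v. - (\<kappa>\<^sup>2 / (4 * pi)) * (2 * (\<Sum>j\<in>UNIV. Re (v $ j * inverse_difference_sum z j))))) (at z)"
    by (intro has_derivative_mult_right has_derivative_log_distance_sum assms)
  moreover have "(\<lambda>v. - (\<kappa>\<^sup>2 / (4 * pi)) * (2 * (\<Sum>j\<in>UNIV. Re (v $ j * inverse_difference_sum z j))))
    = vortex_symplectic \<kappa> (velocity \<kappa> z)"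
  proof
    fix v
    have "Im (cnj (velocity \<kappa> z $ j) * v $ j) = - (\<kappa> / (4 * pi)) * Re (v $ j * inverse_difference_sum z j)" for j
    proof -
      have "Im (cnj (\<i> * complex_of_real c * cnj S) * w) = - c * Re (w * S)" for c S w
        by (simp add: algebra_simps)
      then show ?thesis by (simp only: velocity_def vec_lambda_beta)
    qed
    then show "- (\<kappa>\<^sup>2 / (4 * pi)) * (2 * (\<Sum>j\<in>UNIV. Re (v $ j * inverse_difference_sum z j)))
        = vortex_symplectic \<kappa> (velocity \<kappa> z) v"
      by (simp only: vortex_symplectic_eq_Im sum_distrib_left[symmetric]) (simp add: power2_eq_square)
  qed
  ultimately show ?thesis
    by (simp add: vortex_hamiltonian_eq[abs_def])
qed

text \<open>
Nondegeneracy of the symplectic form determines the vector field from \<open>dH\<close>; evaluation at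
vectors supported in one component suffices.
\<close>

lemma vortex_symplectic_inject:
  assumes "\<kappa> \<noteq> 0" and eq: "vortex_symplectic \<kappa> u = vortex_symplectic \<kappa> w"
  shows "u = w"
proof -
  have "u $ i = w $ i" for i
  proof -
    have single: "vortex_symplectic \<kappa> u (axis i c) = 2 * \<kappa> * Im (cnj (u $ i) * c)" for u c
    proof -
      have "(\<Sum>j\<in>UNIV. Im (cnj (u $ j) * axis i c $ j)) = (\<Sum>j\<in>UNIV. if j = i then Im (cnj (u $ i) * c) else 0)"
        by (intro sum.cong) (auto simp: axis_def)
      then show ?thesis by (simp add: vortex_symplectic_eq_Im)
    qed
    have "Im (cnj (u $ i) * c) = Im (cnj (w $ i) * c)" for c
      using fun_cong[OF eq, of "axis i c"] \<open>\<kappa> \<noteq> 0\<close> by (simp add: single)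
    from this[of 1] this[of \<i>] show ?thesis
      by (simp add: complex_eq_iff)
  qed
  then show ?thesis by (simp add: vec_eq_iff)
qed

lemma integral_curve_iff_velocity:
  fixes \<gamma> :: "real \<Rightarrow> complex ^ ('n :: {finite, linorder})"
  assumes "\<kappa> \<noteq> 0"
  shows "integral_curve \<kappa> I \<gamma> \<longleftrightarrow> open I \<and> is_interval I \<and>
    (\<forall>t\<in>I. \<gamma> t \<in> configurations \<and> (\<gamma> has_vector_derivative velocity \<kappa> (\<gamma> t)) (at t))"
proof -
  have "(\<exists>X. (\<gamma> has_vector_derivative X) (at t) \<and>
            (vortex_hamiltonian \<kappa> has_derivative vortex_symplectic \<kappa> X) (at (\<gamma> t)))
    \<longleftrightarrow> (\<gamma> has_vector_derivative velocity \<kappa> (\<gamma> t)) (at t)" if "\<gamma> t \<in> configurations" for t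
    using has_derivative_vortex_hamiltonian[OF that, of \<kappa>] vortex_symplectic_inject[OF assms]
      has_derivative_unique by metis
  then show ?thesis
    unfolding integral_curve_def by blast
qed

section \<open>Trajectories without close encounters\<close>

text \<open>
On these sets the vector field is bounded and globally Lipschitz, although they are in
general neither convex nor compact.
\<close>

definition separated :: "real \<Rightarrow> (complex ^ 'n) set" where
  "separated d = {z. \<forall>i j. i \<noteq> j \<longrightarrow> d \<le> cmod (z $ i - z $ j)}"

lemma norm_vec_le_sum: "norm (v :: complex ^ 'n) \<le> (\<Sum>j\<in>UNIV. cmod (v $ j))"
  unfolding norm_vec_def by (rule L2_set_le_sum) simp

lemma velocity_bounded:
  fixes z :: "complex ^ 'n"
  assumes "d > 0" "z \<in> separated d"
  shows "norm (velocity \<kappa> z) \<le> real CARD('n) * (\<bar>\<kappa>\<bar> / (4 * pi) * (real CARD('n) * (1 / d)))"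
proof -
  have "cmod (inverse_difference_sum z j) \<le> real CARD('n) * (1 / d)" for j
  proof -
    have "cmod (inverse_difference_sum z j) \<le> (\<Sum>i\<in>- {j}. 1 / d)"
      unfolding inverse_difference_sum_def
    proof (rule sum_norm_le)
      fix i assume "i \<in> - {j}"
      then have "d \<le> cmod (z $ j - z $ i)" using assms by (auto simp: separated_def)
      then show "cmod (1 / (z $ j - z $ i)) \<le> 1 / d"
        using frac_le[of 1 1 d] assms(1) by (simp add: norm_divide)
    qed
    also have "\<dots> \<le> (\<Sum>i\<in>(UNIV::'n set). 1 / d)"
      using assms by (intro sum_mono2) auto
    finally show ?thesis by simp
  qed
  then have "cmod (velocity \<kappa> z $ j) \<le> \<bar>\<kappa>\<bar> / (4 * pi) * (real CARD('n) * (1 / d))" for j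
    by (simp add: velocity_def norm_mult norm_divide del: times_divide_eq_left times_divide_eq_right)
      (intro mult_left_mono, auto)
  then have "(\<Sum>j\<in>UNIV. cmod (velocity \<kappa> z $ j)) \<le> real CARD('n) * (\<bar>\<kappa>\<bar> / (4 * pi) * (real CARD('n) * (1 / d)))"
    by (intro sum_bounded_above)
  then show ?thesis by (rule order_trans[OF norm_vec_le_sum])
qed

lemma velocity_lipschitz:
  assumes "d > 0"
  obtains L where "L-lipschitz_on (separated d :: (complex ^ 'n) set) (velocity \<kappa>)"
proof
  show "(real CARD('n) * (\<bar>\<kappa>\<bar> / (4 * pi) * (real CARD('n) * (2 / d\<^sup>2))))-lipschitz_on
    (separated d :: (complex ^ 'n) set) (velocity \<kappa>)"
  proof (rule lipschitz_onI)
    fix z w :: "complex ^ 'n" assume zw: "z \<in> separated d" "w \<in> separated d"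
    have "cmod (inverse_difference_sum z j - inverse_difference_sum w j)
       \<le> real CARD('n) * (2 / d\<^sup>2 * norm (z - w))" for j
    proof -
      have "cmod (1 / (z $ j - z $ i) - 1 / (w $ j - w $ i)) \<le> 2 / d\<^sup>2 * norm (z - w)" if "i \<noteq> j" for i
      proof -
        let ?a = "z $ j - z $ i" and ?b = "w $ j - w $ i"
        have ab: "cmod ?a \<ge> d" "cmod ?b \<ge> d"
          using zw that by (auto simp: separated_def)
        then have ab0: "?a \<noteq> 0" "?b \<noteq> 0"
          using assms by (metis norm_zero not_less)+
        have "1 / ?a - 1 / ?b = (?b - ?a) / (?a * ?b)"
          using ab0 by (simp add: divide_simps)
        then have "cmod (1 / ?a - 1 / ?b) = cmod (?b - ?a) / (cmod ?a * cmod ?b)"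
          by (simp add: norm_divide norm_mult)
        also have "\<dots> \<le> cmod (?b - ?a) / (d * d)"
          using ab ab0 assms by (intro divide_left_mono mult_mono) auto
        also have "cmod (?b - ?a) = cmod ((z - w) $ i - (z - w) $ j)"
          by (simp add: algebra_simps)
        also have "\<dots> \<le> norm (z - w) + norm (z - w)"
          by (intro order_trans[OF norm_triangle_ineq4] add_mono Finite_Cartesian_Product.norm_nth_le)
        finally show ?thesis
          using assms by (simp add: power2_eq_square divide_right_mono)
      qed
      then have "cmod (inverse_difference_sum z j - inverse_difference_sum w j)
        \<le> (\<Sum>i\<in>- {j}. 2 / d\<^sup>2 * norm (z - w))"
        unfolding inverse_difference_sum_def sum_subtractf[symmetric] by (intro sum_norm_le) auto
      also have "\<dots> \<le> (\<Sum>i\<in>(UNIV::'n set). 2 / d\<^sup>2 * norm (z - w))"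
        by (intro sum_mono2) auto
      finally show ?thesis by simp
    qed
    then have "cmod ((velocity \<kappa> z - velocity \<kappa> w) $ j)
      \<le> \<bar>\<kappa>\<bar> / (4 * pi) * (real CARD('n) * (2 / d\<^sup>2 * norm (z - w)))" for j
      by (simp add: velocity_def norm_mult norm_divide right_diff_distrib[symmetric]
          complex_cnj_diff[symmetric] del: times_divide_eq_left times_divide_eq_right complex_cnj_diff)
        (intro mult_left_mono, auto)
    then have "(\<Sum>j\<in>UNIV. cmod ((velocity \<kappa> z - velocity \<kappa> w) $ j))
      \<le> real CARD('n) * (\<bar>\<kappa>\<bar> / (4 * pi) * (real CARD('n) * (2 / d\<^sup>2 * norm (z - w))))"
      by (intro sum_bounded_above)
    then have "norm (velocity \<kappa> z - velocity \<kappa> w)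
      \<le> real CARD('n) * (\<bar>\<kappa>\<bar> / (4 * pi) * (real CARD('n) * (2 / d\<^sup>2 * norm (z - w))))"
      by (rule order_trans[OF norm_vec_le_sum])
    then show "dist (velocity \<kappa> z) (velocity \<kappa> w)
      \<le> real CARD('n) * (\<bar>\<kappa>\<bar> / (4 * pi) * (real CARD('n) * (2 / d\<^sup>2))) * dist z w"
      by (simp only: dist_norm mult.assoc)
  qed simp
qed

lemma separated_cball:
  fixes z :: "complex ^ 'n"
  assumes "z \<in> separated d"
  shows "cball z (d / 4) \<subseteq> separated (d / 2)"
proof
  fix w assume "w \<in> cball z (d / 4)"
  then have zw: "norm (z - w) \<le> d / 4" by (simp add: dist_norm)
  have "d / 2 \<le> cmod (w $ i - w $ j)" if "i \<noteq> j" for i j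
  proof -
    have "d \<le> cmod (z $ i - z $ j)" using that \<open>z \<in> separated d\<close> by (simp add: separated_def)
    also have "z $ i - z $ j = (w $ i - w $ j) + ((z - w) $ i - (z - w) $ j)" by simp
    also have "cmod \<dots> \<le> cmod (w $ i - w $ j) + (cmod ((z - w) $ i) + cmod ((z - w) $ j))"
      by (intro order_trans[OF norm_triangle_ineq] add_left_mono norm_triangle_ineq4)
    also have "\<dots> \<le> cmod (w $ i - w $ j) + (d / 4 + d / 4)"
      using zw Finite_Cartesian_Product.norm_nth_le order_trans by (intro add_left_mono add_mono) blast+
    finally show ?thesis by simp
  qed
  then show "w \<in> separated (d / 2)" by (simp add: separated_def)
qed

text \<open>
The minimum distance of two vortices; the element 1 covers the case of a single vortex.
\<close>

lemma separated_exists: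
  fixes z :: "complex ^ 'n"
  assumes "z \<in> configurations"
  obtains d where "d > 0" "z \<in> separated d"
proof -
  let ?S = "insert 1 ((\<lambda>(i, j). cmod (z $ i - z $ j)) ` {(i, j). i \<noteq> j})"
  have "finite ?S" by simp
  show ?thesis
  proof
    have "\<forall>a\<in>?S. a > 0" using assms by (auto simp: configurations_def)
    then show "Min ?S > 0" using Min_in[OF \<open>finite ?S\<close>] by blast
    show "z \<in> separated (Min ?S)"
      unfolding separated_def
    proof (intro CollectI allI impI)
      fix i j :: 'n assume "i \<noteq> j"
      then have "cmod (z $ i - z $ j) \<in> ?S"
        by (intro insertI2 image_eqI[of _ _ "(i, j)"]) auto
      then show "Min ?S \<le> cmod (z $ i - z $ j)" using \<open>finite ?S\<close> by (rule Min_le[rotated])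
    qed
  qed
qed

text \<open>
A maximal trajectory cannot end in finite time while all distances between vortices stay at
least \<open>d\<close>: the ball of radius \<open>d / 4\<close> around each point lies in a region with uniform bounds
on the vector field, so that \<open>solution_extension\<close> would contradict maximality.
\<close>

lemma trajectory_in_separated_is_global:
  fixes \<gamma> :: "real \<Rightarrow> complex ^ ('n :: {finite, linorder})"
  assumes "\<kappa> \<noteq> 0" "d > 0" and traj: "trajectory \<kappa> I \<gamma>" and "I \<noteq> {}"
    and sep: "\<And>t. t \<in> I \<Longrightarrow> \<gamma> t \<in> separated d"
  shows "I = UNIV"
proof (rule ccontr)
  assume "I \<noteq> UNIV"
  have I: "open I" "is_interval I"
    and deriv: "\<And>t. t \<in> I \<Longrightarrow> (\<gamma> has_vector_derivative velocity \<kappa> (\<gamma> t)) (at t)"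
    using traj \<open>\<kappa> \<noteq> 0\<close> by (auto simp: trajectory_def integral_curve_iff_velocity)
  have sub: "cball z (d / 4) \<subseteq> separated (d / 2)" if "z \<in> separated d" for z :: "(complex, 'n) vec"
    using separated_cball[OF that] .
  have "d / 2 > 0" using \<open>d > 0\<close> by simp
  then obtain L where L: "L-lipschitz_on (separated (d / 2)) (velocity \<kappa> :: (complex, 'n) vec \<Rightarrow> _)"
    using velocity_lipschitz by blast
  have x: "cball (\<gamma> t) (d / 4) \<subseteq> separated (d / 2) \<and> (\<gamma> has_vector_derivative velocity \<kappa> (\<gamma> t)) (at t)"
    if "t \<in> I" for t using sub[OF sep[OF that]] deriv[OF that] by blast
  have "d / 4 > 0" using \<open>d > 0\<close> by simp
  obtain J \<delta> where J: "open J" "is_interval J" "I \<subset> J" and agree: "\<And>t. t \<in> I \<Longrightarrow> \<delta> t = \<gamma> t"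
    and \<delta>: "\<And>t. t \<in> J \<Longrightarrow> \<delta> t \<in> separated (d / 2) \<and> (\<delta> has_vector_derivative velocity \<kappa> (\<delta> t)) (at t)"
    using solution_extension[OF L velocity_bounded[OF \<open>d / 2 > 0\<close>] \<open>d / 4 > 0\<close> I \<open>I \<noteq> {}\<close> \<open>I \<noteq> UNIV\<close> x]
    by blast
  have "separated (d / 2) \<subseteq> (configurations :: (complex, 'n) vec set)"
    using \<open>d > 0\<close> by (fastforce simp: separated_def configurations_def)
  then have "integral_curve \<kappa> J \<delta>"
    using J \<delta> \<open>\<kappa> \<noteq> 0\<close> by (auto simp: integral_curve_iff_velocity)
  then show False
    using traj J agree unfolding trajectory_def by blast
qed

section \<open>Conservation laws and rotations\<close>

text \<open>
The coefficient \<open>c\<close> is a Lagrange multiplier for the moment of inertia; a suitable choice makes a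
given relative equilibrium a critical point.
\<close>

definition augmented_energy :: "real \<Rightarrow> complex ^ ('n :: {finite, linorder}) \<Rightarrow> real" where
  "augmented_energy c z = log_distance_sum z - c * (norm z)\<^sup>2"

text \<open>
The sum is real since the two terms of each pair add up to 1. Its imaginary part is, up to a
factor, the time derivative of the moment of inertia.
\<close>

lemma Im_virial_eq_0:
  fixes z :: "complex ^ 'n"
  assumes "z \<in> configurations"
  shows "Im (\<Sum>j\<in>UNIV. z $ j * inverse_difference_sum z j) = 0"
proof -
  let ?f = "\<lambda>j i. Im (z $ j / (z $ j - z $ i))"
  have "?f j i + ?f i j = 0" if "i \<in> - {j}" for i j
  proof -
    have "z $ j - z $ i \<noteq> 0"
      using that assms by (auto simp: configurations_def)
    moreover have "z $ i / (z $ i - z $ j) = - (z $ i / (z $ j - z $ i))"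
      by (metis minus_diff_eq minus_divide_right)
    ultimately have "z $ j / (z $ j - z $ i) + z $ i / (z $ i - z $ j) = 1"
      by (simp add: diff_divide_distrib[symmetric])
    then show ?thesis by (metis one_complex.simps(2) plus_complex.simps(2))
  qed
  then have "(\<Sum>j\<in>UNIV. \<Sum>i\<in>- {j}. ?f j i + ?f i j) = 0"
    by simp
  then have "(\<Sum>j\<in>UNIV. \<Sum>i\<in>- {j}. ?f j i) = 0"
    unfolding sum.distrib using sum_off_diagonal_swap[of "\<lambda>j i. ?f i j"] by linarith
  then show ?thesis
    by (simp add: inverse_difference_sum_def sum_distrib_left Im_sum)
qed

text \<open>
The first summand is conserved since the velocity of vortex \<open>j\<close> is \<open>\<i>\<close> times a real multiple of the
conjugate of \<open>inverse_difference_sum z j\<close>, which represents the partial derivative; the second one by \<open>Im_virial_eq_0\<close>.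
\<close>

lemma augmented_energy_conserved:
  fixes \<gamma> :: "real \<Rightarrow> complex ^ ('n :: {finite, linorder})"
  assumes "\<kappa> \<noteq> 0" and curve: "integral_curve \<kappa> I \<gamma>" and "s \<in> I" "t \<in> I"
  shows "augmented_energy c (\<gamma> s) = augmented_energy c (\<gamma> t)"
proof -
  have I: "open I" "is_interval I"
    and conf: "\<And>t. t \<in> I \<Longrightarrow> \<gamma> t \<in> configurations"
    and deriv: "\<And>t. t \<in> I \<Longrightarrow> (\<gamma> has_vector_derivative velocity \<kappa> (\<gamma> t)) (at t)"
    using curve \<open>\<kappa> \<noteq> 0\<close> by (auto simp: integral_curve_iff_velocity)
  have "((\<lambda>t. augmented_energy c (\<gamma> t)) has_derivative (\<lambda>u. 0)) (at t)" if "t \<in> I" for t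
  proof -
    define S where "S = inverse_difference_sum (\<gamma> t)"
    define X where "X = velocity \<kappa> (\<gamma> t)"
    have \<gamma>: "(\<gamma> has_derivative (\<lambda>u. u *\<^sub>R X)) (at t)"
      using deriv[OF that] by (simp add: has_vector_derivative_def X_def)
    have "Re (X $ j * S j) = 0" for j
      by (simp add: X_def velocity_def S_def[symmetric] algebra_simps)
    then have log0: "(\<Sum>j\<in>UNIV. Re ((u *\<^sub>R X) $ j * S j)) = 0" for u
    proof -
      have "Re ((u *\<^sub>R X) $ j * S j) = u * Re (X $ j * S j)" for j
        by (simp add: algebra_simps)
      then show ?thesis using \<open>\<And>j. Re (X $ j * S j) = 0\<close> by simp
    qed
    have "\<gamma> t $ j \<bullet> X $ j = (\<kappa> / (4 * pi)) * Im (\<gamma> t $ j * S j)" for j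
      by (simp add: X_def velocity_def S_def[symmetric] inner_complex_def algebra_simps)
    then have "\<gamma> t \<bullet> X = (\<kappa> / (4 * pi)) * Im (\<Sum>j\<in>UNIV. \<gamma> t $ j * S j)"
      by (simp only: inner_vec_def sum_distrib_left[symmetric] Im_sum)
    then have norm0: "\<gamma> t \<bullet> X = 0"
      using Im_virial_eq_0[OF conf[OF that]] by (simp add: S_def)
    have "((\<lambda>t. log_distance_sum (\<gamma> t)) has_derivative (\<lambda>u. 0)) (at t)"
      using has_derivative_compose[OF \<gamma> has_derivative_log_distance_sum[OF conf[OF that]]] log0
      by (simp only: S_def mult_zero_right)
    moreover have "((\<lambda>t. \<gamma> t \<bullet> \<gamma> t) has_derivative (\<lambda>u. 0)) (at t)"
      by (rule has_derivative_eq_rhs[OF has_derivative_inner[OF \<gamma> \<gamma>]])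
        (use norm0 in \<open>auto simp: inner_commute\<close>)
    ultimately have "((\<lambda>t. log_distance_sum (\<gamma> t) - c * (\<gamma> t \<bullet> \<gamma> t)) has_derivative (\<lambda>u. 0)) (at t)"
      by (intro has_derivative_eq_rhs[OF has_derivative_diff[OF _ has_derivative_mult_right]]) auto
    then show ?thesis
      by (simp add: augmented_energy_def power2_norm_eq_inner)
  qed
  then have "\<exists>c'. \<forall>t\<in>I. augmented_energy c (\<gamma> t) = c'"
    using I by (intro has_derivative_zero_constant) (auto simp: is_interval_convex_1 intro: has_derivative_at_withinI)
  then show ?thesis using \<open>s \<in> I\<close> \<open>t \<in> I\<close> by metis
qed

lemma continuous_on_augmented_energy:
  assumes "A \<subseteq> configurations"
  shows "continuous_on A (augmented_energy c)"
proof -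
  have "isCont log_distance_sum z" if "z \<in> A" for z :: "(complex, 'a) vec"
    using has_derivative_log_distance_sum has_derivative_continuous that assms by blast
  then have "continuous_on A log_distance_sum"
    by (simp add: continuous_at_imp_continuous_on)
  then show ?thesis
    unfolding augmented_energy_def[abs_def] by (intro continuous_intros)
qed

lemma rotate_config_nth [simp]: "rotate_config \<theta> z $ j = cis \<theta> * z $ j"
  by (simp add: rotate_config_def)

lemma rotate_config_rotate [simp]: "rotate_config \<theta> (rotate_config \<phi> z) = rotate_config (\<theta> + \<phi>) z"
  by (simp add: vec_eq_iff cis_mult[symmetric] mult.assoc)

lemma rotate_config_0 [simp]: "rotate_config 0 z = z"
  by (simp add: vec_eq_iff)

lemma cmod_rotate_config_diff [simp]:
  "cmod (cis \<theta> * a - cis \<theta> * b) = cmod (a - b)"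
  by (simp add: right_diff_distrib[symmetric] norm_mult)

lemma norm_rotate_config [simp]: "norm (rotate_config \<theta> z) = norm z"
  by (simp add: norm_vec_def norm_mult)

lemma augmented_energy_rotate [simp]: "augmented_energy c (rotate_config \<theta> z) = augmented_energy c z"
  by (simp add: augmented_energy_def log_distance_sum_def)

lemma separated_rotate: "rotate_config \<theta> z \<in> separated d \<longleftrightarrow> z \<in> separated d"
  by (simp add: separated_def)

section \<open>Stability of strict local maxima\<close>

definition hermitian :: "complex ^ 'n \<Rightarrow> complex ^ 'n \<Rightarrow> complex" where
  "hermitian w z = (\<Sum>j\<in>UNIV. cnj (w $ j) * z $ j)"

text \<open>
The squared distance from \<open>z\<close> to the set of all rotations of \<open>w\<close>: rotating changes only the
argument of the Hermitian product, and \<open>|z - w|\<^sup>2\<close> is smallest when the product is nonnegative.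
\<close>

definition orbit_distance_sq :: "complex ^ 'n \<Rightarrow> complex ^ 'n \<Rightarrow> real" where
  "orbit_distance_sq w z = (norm z)\<^sup>2 + (norm w)\<^sup>2 - 2 * cmod (hermitian w z)"

lemma hermitian_rotate: "hermitian w (rotate_config \<theta> z) = cis \<theta> * hermitian w z"
  by (simp add: hermitian_def sum_distrib_left mult_ac)

lemma orbit_distance_sq_rotate [simp]: "orbit_distance_sq w (rotate_config \<theta> z) = orbit_distance_sq w z"
  by (simp add: orbit_distance_sq_def hermitian_rotate norm_mult)

lemma Re_hermitian: "Re (hermitian w z) = w \<bullet> z"
  by (simp add: hermitian_def inner_vec_def inner_complex_def)

lemma continuous_on_hermitian: "continuous_on A (hermitian w)"
  unfolding hermitian_def by (intro continuous_intros)

lemma continuous_on_orbit_distance_sq: "continuous_on A (orbit_distance_sq w)"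
  unfolding orbit_distance_sq_def by (intro continuous_intros continuous_on_hermitian)

lemma norm_vec_sq: "(norm (z :: complex ^ 'n))\<^sup>2 = (\<Sum>j\<in>UNIV. (cmod (z $ j))\<^sup>2)"
  by (simp add: norm_vec_def L2_set_def sum_nonneg)

lemma orbit_distance_sq_self: "orbit_distance_sq w w = 0"
proof -
  have "hermitian w w = complex_of_real ((norm w)\<^sup>2)"
    unfolding hermitian_def norm_vec_sq of_real_sum complex_norm_square by (simp add: mult.commute)
  then show ?thesis by (simp add: orbit_distance_sq_def norm_power)
qed

text \<open>
Every configuration can be rotated so that \<open>w\<close> is the point of its orbit nearest to it. The
condition on the imaginary part is the slice transversal to the rotations on which the maximum is strict.
\<close>

lemma rotate_to_nearest:
  obtains \<theta> where "Im (hermitian w (rotate_config \<theta> z)) = 0"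
    and "(norm (rotate_config \<theta> z - w))\<^sup>2 = orbit_distance_sq w z"
proof -
  define \<theta> where "\<theta> = - Arg (hermitian w z)"
  have "cis (- Arg u) * rcis (cmod u) (Arg u) = complex_of_real (cmod u)" for u
    by (simp add: rcis_def cis_mult mult.left_commute)
  then have h: "hermitian w (rotate_config \<theta> z) = complex_of_real (cmod (hermitian w z))"
    unfolding hermitian_rotate \<theta>_def rcis_cmod_Arg .
  show ?thesis
  proof
    show "Im (hermitian w (rotate_config \<theta> z)) = 0" by (simp add: h)
    have "w \<bullet> rotate_config \<theta> z = cmod (hermitian w z)"
      unfolding Re_hermitian[symmetric] h by simp
    then show "(norm (rotate_config \<theta> z - w))\<^sup>2 = orbit_distance_sq w z"
      by (simp add: power2_norm_eq_inner inner_diff_left inner_diff_right inner_commute orbit_distance_sq_def)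
        (simp add: power2_norm_eq_inner[symmetric])
  qed
qed

text \<open>
Dirichlet's criterion modulo rotations. The invariant tube of squared radius \<open>\<epsilon>\<^sup>2\<close> around the orbit
replaces the usual ball, and its boundary is, up to rotation, the compact set of those points of
a sphere around \<open>z0\<close> that lie in the slice.
\<close>

lemma strict_local_max_imp_stable:
  fixes z0 :: "complex ^ ('n :: {finite, linorder})"
  assumes "\<kappa> \<noteq> 0" and "z0 \<in> configurations" and orbit: "\<And>t. \<exists>\<theta>. \<gamma> t = rotate_config \<theta> z0" and "\<gamma> 0 = z0"
    and "\<rho> > 0"
    and max: "\<And>z. norm (z - z0) \<le> \<rho> \<Longrightarrow> Im (hermitian z0 z) = 0 \<Longrightarrow> z \<noteq> z0 \<Longrightarrow>
      augmented_energy c z < augmented_energy c z0"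
  shows "stable_modulo_rotations \<kappa> \<gamma>"
  unfolding stable_modulo_rotations_def
proof (intro allI impI)
  fix V assume "invariant_neighbourhood (range \<gamma>) V"
  then have "z0 \<in> interior V" and V_rotate: "\<And>\<theta> z. z \<in> V \<Longrightarrow> rotate_config \<theta> z \<in> V"
    using \<open>\<gamma> 0 = z0\<close> by (auto simp: invariant_neighbourhood_def)
  then obtain e where e: "e > 0" "cball z0 e \<subseteq> V"
    by (meson mem_interior_cball)
  obtain d where d: "d > 0" "z0 \<in> separated d"
    using separated_exists[OF \<open>z0 \<in> configurations\<close>] .
  define \<epsilon> where "\<epsilon> = min \<rho> (min e (d / 4))"
  have \<epsilon>: "\<epsilon> > 0" "\<epsilon> \<le> \<rho>" "\<epsilon> \<le> e" "\<epsilon> \<le> d / 4"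
    using \<open>\<rho> > 0\<close> e d by (auto simp: \<epsilon>_def)
  have cball_V: "cball z0 \<epsilon> \<subseteq> V" using e(2) subset_cball[OF \<epsilon>(3)] by blast
  have cball_sep: "cball z0 \<epsilon> \<subseteq> separated (d / 2)" 
    using separated_cball[OF d(2)] subset_cball[OF \<epsilon>(4)] by blast
  have sep_conf: "separated (d / 2) \<subseteq> configurations"
    using d by (fastforce simp: separated_def configurations_def)
  have near: "z \<in> V \<and> z \<in> separated (d / 2)" if "orbit_distance_sq z0 z \<le> \<epsilon>\<^sup>2" for z
  proof -
    obtain \<theta> where "(norm (rotate_config \<theta> z - z0))\<^sup>2 = orbit_distance_sq z0 z"
      using rotate_to_nearest .
    then have "(norm (rotate_config \<theta> z - z0))\<^sup>2 \<le> \<epsilon>\<^sup>2" using that by simp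
    then have "norm (rotate_config \<theta> z - z0) \<le> \<epsilon>" using \<epsilon> by (simp add: power2_le_iff_abs_le)
    then have in_ball: "rotate_config \<theta> z \<in> cball z0 \<epsilon>" by (simp add: dist_norm norm_minus_commute)
    then have "rotate_config (- \<theta>) (rotate_config \<theta> z) \<in> V" using V_rotate cball_V by blast
    moreover have "rotate_config \<theta> z \<in> separated (d / 2)" using in_ball cball_sep by blast
    ultimately show ?thesis by (simp add: separated_rotate)
  qed
  let ?A = "sphere z0 \<epsilon> \<inter> {z. Im (hermitian z0 z) = 0}"
  have "closed {z. Im (hermitian z0 z) = 0}"
    by (intro closed_Collect_eq continuous_on_Im continuous_on_hermitian continuous_on_const)
  then have "compact ?A"
    by (intro compact_Int_closed compact_sphere)
  have A_sep: "?A \<subseteq> separated (d / 2)" using cball_sep by auto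
  have A_less: "augmented_energy c z < augmented_energy c z0" if "z \<in> ?A" for z
    using that \<epsilon> by (intro max) (auto simp: dist_norm norm_minus_commute)
  obtain M where M: "M < augmented_energy c z0" "\<And>z. z \<in> ?A \<Longrightarrow> augmented_energy c z \<le> M"
  proof (cases "?A = {}")
    case True
    \<comment> \<open>Without boundary points any level below the maximum will do.\<close>
    then have "\<not> z \<in> ?A" for z by (simp only: empty_iff not_False_eq_True)
    then show ?thesis by (intro that[of "augmented_energy c z0 - 1"]) auto
  next
    case False
    have "continuous_on ?A (augmented_energy c)"
      using A_sep sep_conf by (intro continuous_on_augmented_energy) blast
    then obtain w where "w \<in> ?A" "\<And>z. z \<in> ?A \<Longrightarrow> augmented_energy c z \<le> augmented_energy c w"
      using continuous_attains_sup[OF \<open>compact ?A\<close> False] by metis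
    then show ?thesis by (intro that[OF A_less])
  qed
  have barrier: "augmented_energy c z \<le> M" if eq: "orbit_distance_sq z0 z = \<epsilon>\<^sup>2" for z
  proof -
    obtain \<theta> where \<theta>: "Im (hermitian z0 (rotate_config \<theta> z)) = 0"
      "(norm (rotate_config \<theta> z - z0))\<^sup>2 = orbit_distance_sq z0 z"
      using rotate_to_nearest .
    have "norm (rotate_config \<theta> z - z0) = \<epsilon>"
      using \<epsilon>(1) \<theta>(2) unfolding eq by (simp add: power2_eq_iff_nonneg)
    then have "rotate_config \<theta> z \<in> ?A" using \<theta>(1) by (simp add: dist_norm norm_minus_commute)
    then show ?thesis using M(2) by (metis augmented_energy_rotate)
  qed
  let ?N = "{z. orbit_distance_sq z0 z < \<epsilon>\<^sup>2}"
  define U where "U = ?N \<inter> augmented_energy c -` {M<..}"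
  have "open ?N"
    by (intro open_Collect_less continuous_on_orbit_distance_sq continuous_on_const)
  moreover have N_conf: "?N \<subseteq> configurations"
  proof
    fix z assume "z \<in> ?N"
    then have "orbit_distance_sq z0 z \<le> \<epsilon>\<^sup>2" by simp
    then show "z \<in> configurations" using near sep_conf by blast
  qed
  ultimately have "open U"
    unfolding U_def by (intro continuous_open_preimage continuous_on_augmented_energy open_greaterThan)
  have UV: "U \<subseteq> V"
  proof
    fix z assume "z \<in> U"
    then have "orbit_distance_sq z0 z \<le> \<epsilon>\<^sup>2" by (simp add: U_def)
    then show "z \<in> V" using near by blast
  qed
  show "\<exists>U\<subseteq>V. invariant_neighbourhood (range \<gamma>) U \<and>
    (\<forall>I \<delta>. trajectory \<kappa> I \<delta> \<and> 0 \<in> I \<and> \<delta> 0 \<in> U \<longrightarrow> I = UNIV \<and> (\<forall>t. \<delta> t \<in> V))"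
  proof (intro exI conjI allI impI)
    show "U \<subseteq> V" by (rule UV)
    have "\<gamma> t \<in> U" for t
      using orbit[of t] M(1) \<epsilon> by (auto simp: U_def orbit_distance_sq_self)
    then have "range \<gamma> \<subseteq> interior U" using \<open>open U\<close> by (auto simp: interior_open)
    moreover have "U \<subseteq> configurations" using N_conf by (auto simp only: U_def)
    moreover have "\<forall>\<theta>. \<forall>z\<in>U. rotate_config \<theta> z \<in> U" by (simp add: U_def)
    ultimately show "invariant_neighbourhood (range \<gamma>) U"
      unfolding invariant_neighbourhood_def by blast
    fix I \<delta> assume *: "trajectory \<kappa> I \<delta> \<and> 0 \<in> I \<and> \<delta> 0 \<in> U"
    then have curve: "integral_curve \<kappa> I \<delta>" and "0 \<in> I" and start: "\<delta> 0 \<in> U"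
      by (auto simp: trajectory_def)
    have no_cross: "orbit_distance_sq z0 (\<delta> t) \<noteq> \<epsilon>\<^sup>2" if "t \<in> I" for t
    proof
      assume "orbit_distance_sq z0 (\<delta> t) = \<epsilon>\<^sup>2"
      then have "augmented_energy c (\<delta> t) \<le> M" by (rule barrier)
      moreover have "augmented_energy c (\<delta> t) = augmented_energy c (\<delta> 0)"
        using augmented_energy_conserved[OF \<open>\<kappa> \<noteq> 0\<close> curve that \<open>0 \<in> I\<close>] .
      ultimately show False using start by (simp add: U_def)
    qed
    have "isCont \<delta> t" if "t \<in> I" for t
      using curve that unfolding integral_curve_iff_velocity[OF \<open>\<kappa> \<noteq> 0\<close>]
      by (blast intro: has_vector_derivative_continuous)
    then have "continuous_on I \<delta>" by (simp add: continuous_at_imp_continuous_on)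
    have "connected I"
      using curve by (simp add: integral_curve_def is_interval_connected_1)
    have conn: "connected ((\<lambda>t. orbit_distance_sq z0 (\<delta> t)) ` I)"
      by (rule connected_continuous_image[OF continuous_on_compose2[OF continuous_on_orbit_distance_sq
              \<open>continuous_on I \<delta>\<close> subset_UNIV] \<open>connected I\<close>])
    have inside: "orbit_distance_sq z0 (\<delta> t) < \<epsilon>\<^sup>2" if "t \<in> I" for t
    proof (rule ccontr)
      assume "\<not> orbit_distance_sq z0 (\<delta> t) < \<epsilon>\<^sup>2"
      then have "\<epsilon>\<^sup>2 \<in> (\<lambda>t. orbit_distance_sq z0 (\<delta> t)) ` I"
        using start
        by (intro connectedD_interval[OF conn imageI[OF \<open>0 \<in> I\<close>] imageI[OF that]]) (simp_all add: U_def)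
      then obtain u where "\<epsilon>\<^sup>2 = orbit_distance_sq z0 (\<delta> u)" "u \<in> I" by (rule imageE)
      then show False using no_cross[of u] by simp
    qed
    have "I \<noteq> {}" using \<open>0 \<in> I\<close> by blast
    have "\<delta> t \<in> separated (d / 2)" if "t \<in> I" for t
      using near inside[OF that] by simp
    moreover have "d / 2 > 0" using d by simp
    ultimately show "I = UNIV"
      using trajectory_in_separated_is_global[OF \<open>\<kappa> \<noteq> 0\<close> _ conjunct1[OF *] \<open>I \<noteq> {}\<close>] by blast
    then show "\<delta> t \<in> V" for t
      using near inside[of t] by simp
  qed
qed

section \<open>Seventh roots of unity\<close>

abbreviation roots7 :: "complex set" where "roots7 \<equiv> {x. x ^ 7 = 1}"

lemma finite_roots7: "finite roots7"
  by (rule finite_roots_unity) simp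

lemma roots7_nonzero: "x \<in> roots7 \<Longrightarrow> x \<noteq> 0"
  by auto

lemma cmod_roots7: "x \<in> roots7 \<Longrightarrow> cmod x = 1"
  by (metis (mono_tags) mem_Collect_eq norm_ge_zero norm_one norm_power power_eq_imp_eq_base power_one
      zero_le_one zero_less_numeral)

lemma cnj_roots7: "x \<in> roots7 \<Longrightarrow> cnj x = inverse x"
  using cmod_roots7[of x] complex_norm_square[of x] inverse_unique[of x "cnj x"] by simp

text \<open>
Multiplication by the primitive root \<open>\<omega>\<close> permutes the roots and multiplies the sum by \<open>\<omega> ^ k\<close>,
which differs from 1 unless 7 divides \<open>k\<close>.
\<close>

lemma power_sum_roots7: "(\<Sum>x\<in>roots7. x ^ k) = (if 7 dvd k then 7 else 0)"
proof (cases "7 dvd k")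
  case True
  then have "(\<Sum>x\<in>roots7. x ^ k) = (\<Sum>x\<in>roots7. 1)"
    by (intro sum.cong) (auto simp: power_mult elim!: dvdE)
  then show ?thesis using True card_roots_unity_eq[of 7] by simp
next
  case False
  define \<omega> where "\<omega> = cis (2 * pi / 7)"
  have \<omega>_power: "\<omega> ^ j = cis (2 * pi * real j / 7)" for j
    unfolding \<omega>_def Complex.DeMoivre by (simp add: mult_ac)
  then have "\<omega> \<in> roots7" by simp
  have "inj_on (\<lambda>j. \<omega> ^ j) {..<7}"
    using bij_betw_imp_inj_on[OF Complex.bij_betw_roots_unity[of 7]] by (simp add: \<omega>_power)
  moreover have "k mod 7 \<noteq> 0" using False by (simp add: dvd_eq_mod_eq_0)
  ultimately have "\<omega> ^ (k mod 7) \<noteq> \<omega> ^ 0"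
    by (metis inj_on_eq_iff lessThan_iff mod_less_divisor zero_less_numeral)
  moreover have "\<omega> ^ k = \<omega> ^ (k mod 7)"
  proof -
    have "\<omega> ^ k = \<omega> ^ (7 * (k div 7) + k mod 7)" by simp
    also have "\<dots> = \<omega> ^ (k mod 7)"
      using \<open>\<omega> \<in> roots7\<close> unfolding power_add power_mult by simp
    finally show ?thesis .
  qed
  ultimately have "\<omega> ^ k \<noteq> 1" by simp
  have "(\<Sum>x\<in>roots7. x ^ k) = (\<Sum>x\<in>roots7. (\<omega> * x) ^ k)"
    by (rule sum.reindex_bij_witness[of _ "\<lambda>x. \<omega> * x" "\<lambda>x. x / \<omega>"])
      (use \<open>\<omega> \<in> roots7\<close> roots7_nonzero in \<open>auto simp: power_mult_distrib power_divide\<close>)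
  also have "\<dots> = \<omega> ^ k * (\<Sum>x\<in>roots7. x ^ k)"
    by (simp only: power_mult_distrib sum_distrib_left)
  finally have "(\<omega> ^ k - 1) * (\<Sum>x\<in>roots7. x ^ k) = 0"
    by (simp add: left_diff_distrib)
  then show ?thesis using \<open>\<omega> ^ k \<noteq> 1\<close> False by auto
qed

lemma geometric_sum_roots7:
  assumes "t \<in> roots7"
  shows "(\<Sum>m<7. t ^ m) = (if t = 1 then 7 else 0)"
  using assms geometric_sum[of t 7] by auto

lemma power_sum_nontrivial_roots7: "(\<Sum>u\<in>roots7 - {1}. u ^ k) = (if 7 dvd k then 6 else - 1)"
  using sum.remove[OF finite_roots7, of 1 "\<lambda>u. u ^ k"] power_sum_roots7[of k]
  by (auto simp: algebra_simps add_eq_0_iff)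

lemma fourier_inversion:
  assumes "x \<in> roots7"
  shows "f x = (\<Sum>m<7. (\<Sum>y\<in>roots7. f y * cnj y ^ m) / 7 * x ^ m)"
proof -
  have "(\<Sum>m<7. (\<Sum>y\<in>roots7. f y * cnj y ^ m) / 7 * x ^ m)
      = (\<Sum>m<7. \<Sum>y\<in>roots7. f y / 7 * (x / y) ^ m)"
  proof (intro sum.cong refl)
    fix m :: nat
    have "(\<Sum>y\<in>roots7. f y * cnj y ^ m) / 7 * x ^ m = (\<Sum>y\<in>roots7. f y * cnj y ^ m / 7 * x ^ m)"
      by (simp only: sum_divide_distrib sum_distrib_right)
    also have "\<dots> = (\<Sum>y\<in>roots7. f y / 7 * (x / y) ^ m)"
    proof (rule sum.cong[OF refl])
      fix y assume "y \<in> roots7"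
      then have "cnj y ^ m = 1 / y ^ m"
        by (simp add: cnj_roots7 power_inverse inverse_eq_divide power_divide)
      then show "f y * cnj y ^ m / 7 * x ^ m = f y / 7 * (x / y) ^ m"
        by (simp add: power_divide)
    qed
    finally show "(\<Sum>y\<in>roots7. f y * cnj y ^ m) / 7 * x ^ m = (\<Sum>y\<in>roots7. f y / 7 * (x / y) ^ m)" .
  qed
  also have "\<dots> = (\<Sum>y\<in>roots7. f y / 7 * (\<Sum>m<7. (x / y) ^ m))"
    by (subst sum.swap) (simp add: sum_distrib_left)
  also have "\<dots> = (\<Sum>y\<in>roots7. if y = x then f x else 0)"
  proof (intro sum.cong refl)
    fix y assume y: "y \<in> roots7"
    then have "x / y \<in> roots7" using assms by (simp add: power_divide)
    then show "f y / 7 * (\<Sum>m<7. (x / y) ^ m) = (if y = x then f x else 0)"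
      using roots7_nonzero[OF y] by (auto simp: geometric_sum_roots7)
  qed
  also have "\<dots> = f x" using assms finite_roots7 by simp
  finally show ?thesis by simp
qed

text \<open>
On the roots \<open>cnj x = x ^ 6\<close>, so the mixed terms are power sums with the exponents \<open>m + 6 n\<close>,
which are divisible by 7 only on the diagonal.
\<close>

lemma parseval_roots7:
  "(\<Sum>x\<in>roots7. (cmod (\<Sum>m<7. c m * x ^ m))\<^sup>2) = 7 * (\<Sum>m<7. (cmod (c m))\<^sup>2)"
proof -
  have "complex_of_real (\<Sum>x\<in>roots7. (cmod (\<Sum>m<7. c m * x ^ m))\<^sup>2)
      = (\<Sum>x\<in>roots7. (\<Sum>m<7. \<Sum>n<7. c m * cnj (c n) * x ^ (m + 6 * n)))"
    unfolding of_real_sum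
  proof (intro sum.cong refl)
    fix x assume x: "x \<in> roots7"
    then have "x * x ^ 6 = 1" by (simp add: eval_nat_numeral)
    then have "cnj x = x ^ 6"
      using cnj_roots7[OF x] inverse_unique by simp
    then have "cnj (\<Sum>m<7. c m * x ^ m) = (\<Sum>m<7. cnj (c m) * x ^ (6 * m))"
      by (simp add: power_mult)
    then show "complex_of_real ((cmod (\<Sum>m<7. c m * x ^ m))\<^sup>2)
        = (\<Sum>m<7. \<Sum>n<7. c m * cnj (c n) * x ^ (m + 6 * n))"
      by (simp only: complex_norm_square sum_product) (simp add: power_add mult_ac)
  qed
  also have "\<dots> = (\<Sum>m<7. \<Sum>x\<in>roots7. \<Sum>n<7. c m * cnj (c n) * x ^ (m + 6 * n))"
    by (rule sum.swap)
  also have "\<dots> = (\<Sum>m<7. \<Sum>n<7. c m * cnj (c n) * (\<Sum>x\<in>roots7. x ^ (m + 6 * n)))"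
    by (intro sum.cong refl, subst sum.swap) (simp add: sum_distrib_left)
  also have "\<dots> = (\<Sum>m<7. \<Sum>n<7. if n = m then 7 * (c m * cnj (c m)) else 0)"
  proof (intro sum.cong refl)
    fix m n :: nat assume "m \<in> {..<7}" "n \<in> {..<7}"
    then have mn: "m < 7" "n < 7" by auto
    have "7 dvd m + 6 * n \<longleftrightarrow> n = m"
    proof
      assume dvd: "7 dvd m + 6 * n"
      have eqs: "m + 6 * n + (n - m) = 7 * n" if "m \<le> n"
        using that by simp
      show "n = m"
      proof (cases "m \<le> n")
        case True
        then have "7 dvd n - m"
          using eqs dvd dvd_add_right_iff[OF dvd, of "n - m"] by simp
        then show ?thesis using True mn dvd_imp_le[of 7 "n - m"] by linarith
      next
        case False
        then have "m + 6 * n = 7 * n + (m - n)" by simp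
        then have "7 dvd m - n"
          using dvd dvd_add_right_iff[of 7 "7 * n" "m - n"] by (metis dvd_triv_left)
        then show ?thesis using False mn dvd_imp_le[of 7 "m - n"] by linarith
      qed
    qed simp
    then show "c m * cnj (c n) * (\<Sum>x\<in>roots7. x ^ (m + 6 * n)) = (if n = m then 7 * (c m * cnj (c m)) else 0)"
      by (simp add: power_sum_roots7)
  qed
  also have "\<dots> = complex_of_real (7 * (\<Sum>m<7. (cmod (c m))\<^sup>2))"
    by (simp add: complex_norm_square[symmetric] sum_distrib_left)
  finally show ?thesis using of_real_eq_iff by blast
qed

section \<open>Sums over pairs of roots\<close>

text \<open>
Ordered pairs avoid the choice of an order on the roots; as the summands of interest are symmetric,
this only counts every pair twice.
\<close>

definition pair_sum :: "(complex \<Rightarrow> complex \<Rightarrow> 'a::comm_monoid_add) \<Rightarrow> 'a" where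
  "pair_sum F = (\<Sum>x\<in>roots7. \<Sum>y\<in>roots7 - {x}. F x y)"

lemma pair_sum_cong:
  assumes "\<And>x y. x \<in> roots7 \<Longrightarrow> y \<in> roots7 \<Longrightarrow> x \<noteq> y \<Longrightarrow> F x y = G x y"
  shows "pair_sum F = pair_sum G"
  unfolding pair_sum_def by (intro sum.cong) (auto intro: assms)

lemma pair_sum_0: "pair_sum (\<lambda>x y. 0) = 0"
  by (simp add: pair_sum_def)

lemma pair_sum_add: "pair_sum (\<lambda>x y. F x y + G x y) = pair_sum F + pair_sum G"
  by (simp add: pair_sum_def sum.distrib)

lemma pair_sum_diff: "pair_sum (\<lambda>x y. F x y - G x y) = pair_sum F - (pair_sum G :: 'a :: ab_group_add)"
  by (simp add: pair_sum_def sum_subtractf)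

lemma pair_sum_mult_left: "pair_sum (\<lambda>x y. c * F x y) = c * (pair_sum F :: 'a :: semiring_0)"
  by (simp add: pair_sum_def sum_distrib_left)

lemma pair_sum_sum: "pair_sum (\<lambda>x y. \<Sum>i\<in>I. F i x y) = (\<Sum>i\<in>I. pair_sum (F i))"
  unfolding pair_sum_def by (simp add: sum.swap[of _ I])

lemma Re_pair_sum: "Re (pair_sum F) = pair_sum (\<lambda>x y. Re (F x y))"
  by (simp add: pair_sum_def Re_sum)

text \<open>
There are \<open>7 * 6 = 42\<close> ordered pairs.
\<close>

lemma pair_sum_bound:
  fixes F :: "complex \<Rightarrow> complex \<Rightarrow> real"
  assumes "\<And>x y. x \<in> roots7 \<Longrightarrow> y \<in> roots7 \<Longrightarrow> x \<noteq> y \<Longrightarrow> F x y \<le> K"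
  shows "pair_sum F \<le> 42 * K"
proof -
  have "(\<Sum>y\<in>roots7 - {x}. F x y) \<le> 6 * K" if "x \<in> roots7" for x
  proof -
    have "(\<Sum>y\<in>roots7 - {x}. F x y) \<le> of_nat (card (roots7 - {x})) * K"
      by (rule sum_bounded_above) (use that assms in auto)
    then show ?thesis using that card_roots_unity_eq[of 7] by simp
  qed
  then have "pair_sum F \<le> of_nat (card roots7) * (6 * K)"
    unfolding pair_sum_def by (intro sum_bounded_above)
  then show ?thesis using card_roots_unity_eq[of 7] by simp
qed

definition homogeneous :: "nat \<Rightarrow> (complex \<Rightarrow> complex \<Rightarrow> complex) \<Rightarrow> bool" where
  "homogeneous d F \<longleftrightarrow> (\<forall>c x y. F (c * x) (c * y) = c ^ d * F x y)"

lemma homogeneous_mult: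
  "homogeneous d F \<Longrightarrow> homogeneous d' G \<Longrightarrow> homogeneous (d + d') (\<lambda>x y. F x y * G x y)"
  by (simp add: homogeneous_def power_add mult_ac)

text \<open>
Substituting \<open>y = x u\<close> separates the two summations: the one over \<open>x\<close> is a power sum, which kills
all degrees not divisible by 7, and the one over \<open>u\<close> involves a polynomial in one variable only.
\<close>

lemma pair_sum_homogeneous:
  assumes "homogeneous d F"
  shows "pair_sum F = (if 7 dvd d then 7 * (\<Sum>u\<in>roots7 - {1}. F 1 u) else 0)"
proof -
  have "(\<Sum>y\<in>roots7 - {x}. F x y) = x ^ d * (\<Sum>u\<in>roots7 - {1}. F 1 u)" if x: "x \<in> roots7" for x
  proof -
    have "(\<Sum>y\<in>roots7 - {x}. F x y) = (\<Sum>u\<in>roots7 - {1}. F (x * 1) (x * u))"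
      by (rule sum.reindex_bij_witness[of _ "\<lambda>u. x * u" "\<lambda>y. y / x"])
        (use x roots7_nonzero[OF x] in \<open>auto simp: power_mult_distrib power_divide\<close>)
    also have "\<dots> = (\<Sum>u\<in>roots7 - {1}. x ^ d * F 1 u)"
      using assms unfolding homogeneous_def by metis
    finally show ?thesis by (simp add: sum_distrib_left)
  qed
  then have "pair_sum F = (\<Sum>x\<in>roots7. x ^ d * (\<Sum>u\<in>roots7 - {1}. F 1 u))"
    unfolding pair_sum_def by (rule sum.cong[OF refl])
  also have "\<dots> = (\<Sum>x\<in>roots7. x ^ d) * (\<Sum>u\<in>roots7 - {1}. F 1 u)"
    by (simp add: sum_distrib_right)
  finally show ?thesis by (simp add: power_sum_roots7)
qed

section \<open>Difference quotients of monomials\<close>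

text \<open>
The difference quotient of \<open>x ^ m\<close>, written as the polynomial \<open>(x ^ m - y ^ m) / (x - y)\<close>.
\<close>

definition quotient_poly :: "nat \<Rightarrow> complex \<Rightarrow> complex \<Rightarrow> complex" where
  "quotient_poly m x y = (\<Sum>l<m. x ^ l * y ^ (m - Suc l))"

lemma quotient_poly_mult_diff: "(x - y) * quotient_poly m x y = x ^ m - y ^ m"
  unfolding quotient_poly_def power_diff_sumr2[of x m y] by (simp add: mult_ac)

lemma homogeneous_quotient_poly: "homogeneous (m - 1) (quotient_poly m)"
  unfolding homogeneous_def quotient_poly_def
proof (intro allI)
  fix c x y :: complex
  have "(c * x) ^ l * (c * y) ^ (m - Suc l) = c ^ (m - 1) * (x ^ l * y ^ (m - Suc l))" if "l < m" for l
  proof -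
    have "c ^ (m - 1) = c ^ l * c ^ (m - Suc l)"
      using that by (simp add: power_add[symmetric])
    then show ?thesis by (simp add: power_mult_distrib)
  qed
  then show "(\<Sum>l<m. (c * x) ^ l * (c * y) ^ (m - Suc l)) = c ^ (m - 1) * (\<Sum>l<m. x ^ l * y ^ (m - Suc l))"
    by (simp add: sum_distrib_left)
qed

lemma quotient_poly_0 [simp]: "quotient_poly 0 x y = 0"
  by (simp add: quotient_poly_def)

lemma quotient_poly_Suc_0: "quotient_poly (Suc 0) x y = 1"
  by (simp add: quotient_poly_def)

lemma cmod_quotient_poly_le:
  assumes "x \<in> roots7" "y \<in> roots7"
  shows "cmod (quotient_poly m x y) \<le> real m"
proof -
  have "cmod (quotient_poly m x y) \<le> (\<Sum>l<m. 1)"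
    unfolding quotient_poly_def
    using cmod_roots7[OF assms(1)] cmod_roots7[OF assms(2)]
    by (intro sum_norm_le) (simp add: norm_mult norm_power)
  then show ?thesis by simp
qed

lemma pair_sum_quotient_poly:
  assumes "m < 7"
  shows "pair_sum (quotient_poly m) = (if m = 1 then 42 else 0)"
proof -
  have "\<not> 7 dvd (m - 1)" if "m \<ge> 2"
    using assms that by (intro nat_dvd_not_less) auto
  then consider "m = 0" | "m = 1" | "\<not> 7 dvd (m - 1)" "m \<noteq> 1"
    by linarith
  then show ?thesis
  proof cases
    case 1 then show ?thesis by (simp add: pair_sum_def)
  next
    case 2 then show ?thesis
      using pair_sum_homogeneous[OF homogeneous_quotient_poly[of m]] power_sum_nontrivial_roots7[of 0]
      by (simp add: quotient_poly_def)
  next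
    case 3 then show ?thesis
      using pair_sum_homogeneous[OF homogeneous_quotient_poly[of m]] by simp
  qed
qed

text \<open>
The degree is \<open>m + n - 2\<close>, so that only \<open>m + n = 2\<close> and \<open>m + n = 9\<close> survive. These numbers are the
coefficients of the quadratic part of the logarithmic energy, up to the factor \<open>- 1 / 2\<close>.
\<close>

lemma pair_sum_quotient_poly2:
  assumes "m < 7" "n < 7"
  shows "pair_sum (\<lambda>x y. quotient_poly m x y * quotient_poly n x y) =
    (if m = 1 \<and> n = 1 then 42
     else if m = 3 \<and> n = 6 \<or> m = 6 \<and> n = 3 then - 28
     else if m = 4 \<and> n = 5 \<or> m = 5 \<and> n = 4 then - 42 else 0)"
proof -
  have hom: "homogeneous (m - 1 + (n - 1)) (\<lambda>x y. quotient_poly m x y * quotient_poly n x y)"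
    by (intro homogeneous_mult homogeneous_quotient_poly)
  have e36: "quotient_poly 3 1 u * quotient_poly 6 1 u
     = u^0 + 2 * u^1 + 3 * u^2 + 3 * u^3 + 3 * u^4 + 3 * u^5 + 2 * u^6 + u^7" for u
    by (simp add: quotient_poly_def eval_nat_numeral algebra_simps)
  have e45: "quotient_poly 4 1 u * quotient_poly 5 1 u
     = u^0 + 2 * u^1 + 3 * u^2 + 4 * u^3 + 4 * u^4 + 3 * u^5 + 2 * u^6 + u^7" for u
    by (simp add: quotient_poly_def eval_nat_numeral algebra_simps)
  have s36: "(\<Sum>u\<in>roots7 - {1}. quotient_poly 3 1 u * quotient_poly 6 1 u) = - 4"
    unfolding e36 sum.distrib sum_distrib_left[symmetric] power_sum_nontrivial_roots7 by simp
  have s45: "(\<Sum>u\<in>roots7 - {1}. quotient_poly 4 1 u * quotient_poly 5 1 u) = - 6"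
    unfolding e45 sum.distrib sum_distrib_left[symmetric] power_sum_nontrivial_roots7 by simp
  have s11: "(\<Sum>u\<in>roots7 - {1}. quotient_poly 1 1 u * quotient_poly 1 1 u) = 6"
    using power_sum_nontrivial_roots7[of 0] by (simp add: quotient_poly_def)
  have pairs: "m = 1 \<and> n = 1 \<or> m = 3 \<and> n = 6 \<or> m = 6 \<and> n = 3 \<or> m = 4 \<and> n = 5 \<or> m = 5 \<and> n = 4"
    if dvd7: "7 dvd (m - 1 + (n - 1))" and pos: "m \<noteq> 0" "n \<noteq> 0"
  proof -
    obtain k where k: "m - 1 + (n - 1) = 7 * k" using dvd7 by (elim dvdE)
    have "k < 2" using k assms by linarith
    then consider "k = 0" | "k = 1" by linarith
    then show ?thesis
    proof cases
      case 1 then show ?thesis using k pos by simp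
    next
      case 2
      then have "n = 9 - m" "m < 7" "3 \<le> m" using k pos assms by linarith+
      moreover from this have "m = 3 \<or> m = 4 \<or> m = 5 \<or> m = 6" by linarith
      ultimately show ?thesis by auto
    qed
  qed
  consider "m = 0 \<or> n = 0" | "m = 1" "n = 1" | "m = 3" "n = 6" | "m = 6" "n = 3" | "m = 4" "n = 5" | "m = 5" "n = 4"
    | "\<not> 7 dvd (m - 1 + (n - 1))" "m \<noteq> 0" "n \<noteq> 0"
    using pairs by blast
  then show ?thesis
  proof cases
    case 1 then show ?thesis by (auto simp: pair_sum_def)
  next
    case 7 then show ?thesis
      using pair_sum_homogeneous[OF hom] assms by (auto simp: numeral_eq_Suc)
  qed (use pair_sum_homogeneous[OF hom] s36 s45 s11 in \<open>simp_all add: mult.commute\<close>)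
qed

lemma homogeneous_quotient_poly3:
  "homogeneous (a - 1 + (b - 1) + (c - 1)) (\<lambda>x y. quotient_poly a x y * quotient_poly b x y * quotient_poly c x y)"
  by (intro homogeneous_mult homogeneous_quotient_poly)

lemma homogeneous_quotient_poly4:
  "homogeneous (a - 1 + (b - 1) + (c - 1) + (d - 1))
    (\<lambda>x y. quotient_poly a x y * quotient_poly b x y * quotient_poly c x y * quotient_poly d x y)"
  by (intro homogeneous_mult homogeneous_quotient_poly)

lemma pair_sum_quotient_poly_442:
  "pair_sum (\<lambda>x y. quotient_poly 4 x y * quotient_poly 4 x y * quotient_poly 2 x y) = - 126"
proof -
  have "quotient_poly 4 1 u * quotient_poly 4 1 u * quotient_poly 2 1 u
     = u^0 + 3 * u^1 + 5 * u^2 + 7 * u^3 + 7 * u^4 + 5 * u^5 + 3 * u^6 + u^7" for u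
    by (simp add: quotient_poly_def eval_nat_numeral algebra_simps)
  then have "(\<Sum>u\<in>roots7 - {1}. quotient_poly 4 1 u * quotient_poly 4 1 u * quotient_poly 2 1 u) = - 18"
    by (simp only: sum.distrib sum_distrib_left[symmetric] power_sum_nontrivial_roots7) simp
  then show ?thesis
    using pair_sum_homogeneous[OF homogeneous_quotient_poly3[of 4 4 2]] by simp
qed

lemma pair_sum_quotient_poly_4455:
  "pair_sum (\<lambda>x y. quotient_poly 4 x y * quotient_poly 4 x y * quotient_poly 5 x y * quotient_poly 5 x y) = 238"
proof -
  have e45: "quotient_poly 4 1 u * quotient_poly 5 1 u
     = 1 + 2 * u + 3 * u^2 + 4 * u^3 + 4 * u^4 + 3 * u^5 + 2 * u^6 + u^7" for u
    by (simp add: quotient_poly_def eval_nat_numeral algebra_simps)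
  have "quotient_poly 4 1 u * quotient_poly 4 1 u * quotient_poly 5 1 u * quotient_poly 5 1 u
     = u^0 + 4 * u^1 + 10 * u^2 + 20 * u^3 + 33 * u^4 + 46 * u^5 + 56 * u^6 + 60 * u^7
       + 56 * u^8 + 46 * u^9 + 33 * u^10 + 20 * u^11 + 10 * u^12 + 4 * u^13 + u^14" for u
  proof -
    have "quotient_poly 4 1 u * quotient_poly 4 1 u * quotient_poly 5 1 u * quotient_poly 5 1 u
      = (quotient_poly 4 1 u * quotient_poly 5 1 u)\<^sup>2" by (simp add: power2_eq_square)
    then show ?thesis unfolding e45 by algebra
  qed
  then have "(\<Sum>u\<in>roots7 - {1}. quotient_poly 4 1 u * quotient_poly 4 1 u * quotient_poly 5 1 u * quotient_poly 5 1 u) = 34"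
    by (simp only: sum.distrib sum_distrib_left[symmetric] power_sum_nontrivial_roots7) simp
  then show ?thesis
    using pair_sum_homogeneous[OF homogeneous_quotient_poly4[of 4 4 5 5]] by simp
qed

section \<open>Taylor coefficients of the logarithmic energy\<close>

text \<open>
For the perturbation \<open>x \<mapsto> x + g x\<close> of the roots with \<open>g x = (\<Sum>m<7. b m * x ^ m)\<close> this is
\<open>(g x - g y) / (x - y)\<close>, the relative change of the difference of two vortices.
\<close>

definition relative_displacement :: "(nat \<Rightarrow> complex) \<Rightarrow> complex \<Rightarrow> complex \<Rightarrow> complex" where
  "relative_displacement b x y = (\<Sum>m<7. b m * quotient_poly m x y)"

text \<open>
The kernel of the second variation, apart from rotation: the Fourier coefficients 4 and 5
satisfy \<open>b 5 = cnj (b 4)\<close>.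
\<close>

definition critical_mode :: "complex \<Rightarrow> nat \<Rightarrow> complex" where
  "critical_mode q = (\<lambda>m. 0)(4 := q, 5 := cnj q)"

lemma lessThan_7: "{..<7::nat} = {0, 1, 2, 3, 4, 5, 6}"
  by auto

lemma relative_displacement_mult_diff:
  "(x - y) * relative_displacement b x y = (\<Sum>m<7. b m * x ^ m) - (\<Sum>m<7. b m * y ^ m)"
proof -
  have "(x - y) * relative_displacement b x y = (\<Sum>m<7. b m * ((x - y) * quotient_poly m x y))"
    unfolding relative_displacement_def sum_distrib_left by (simp add: mult_ac)
  then show ?thesis
    by (simp add: quotient_poly_mult_diff right_diff_distrib sum_subtractf)
qed

lemma cmod_relative_displacement_le:
  assumes "x \<in> roots7" "y \<in> roots7"
  shows "cmod (relative_displacement b x y) \<le> (\<Sum>m<7. real m * cmod (b m))"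
  unfolding relative_displacement_def
proof (rule sum_norm_le)
  fix m
  show "cmod (b m * quotient_poly m x y) \<le> real m * cmod (b m)"
    unfolding norm_mult using mult_left_mono[OF cmod_quotient_poly_le[OF assms] norm_ge_zero]
    by (simp add: mult.commute)
qed

lemma relative_displacement_critical_mode:
  "relative_displacement (critical_mode q) x y = q * quotient_poly 4 x y + cnj q * quotient_poly 5 x y"
  by (simp add: relative_displacement_def critical_mode_def lessThan_7)

lemma pair_sum_relative_displacement: "pair_sum (relative_displacement b) = 42 * b 1"
proof -
  have "pair_sum (relative_displacement b) = (\<Sum>m<7. b m * pair_sum (quotient_poly m))"
    unfolding relative_displacement_def[abs_def] pair_sum_sum pair_sum_mult_left ..
  also have "\<dots> = (\<Sum>m<7. b m * (if m = 1 then 42 else 0))"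
    by (intro sum.cong refl) (simp add: pair_sum_quotient_poly)
  finally show ?thesis by (simp add: lessThan_7)
qed

lemma pair_sum_relative_displacement_sq:
  "pair_sum (\<lambda>x y. (relative_displacement b x y)\<^sup>2) = 42 * (b 1)\<^sup>2 - 56 * (b 3 * b 6) - 84 * (b 4 * b 5)"
proof -
  have "pair_sum (\<lambda>x y. (relative_displacement b x y)\<^sup>2)
      = pair_sum (\<lambda>x y. \<Sum>m<7. \<Sum>n<7. (b m * b n) * (quotient_poly m x y * quotient_poly n x y))"
    by (simp add: relative_displacement_def power2_eq_square sum_product mult_ac)
  also have "\<dots> = (\<Sum>m<7. \<Sum>n<7. (b m * b n) * pair_sum (\<lambda>x y. quotient_poly m x y * quotient_poly n x y))"
    by (simp only: pair_sum_sum pair_sum_mult_left)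
  also have "\<dots> = (\<Sum>m<7. \<Sum>n<7. (b m * b n) * (if m = 1 \<and> n = 1 then 42
     else if m = 3 \<and> n = 6 \<or> m = 6 \<and> n = 3 then - 28
     else if m = 4 \<and> n = 5 \<or> m = 5 \<and> n = 4 then - 42 else 0))"
    by (intro sum.cong refl arg_cong2[where f = "(*)"] pair_sum_quotient_poly2) auto
  also have "\<dots> = 42 * (b 1)\<^sup>2 - 56 * (b 3 * b 6) - 84 * (b 4 * b 5)"
    by (simp add: lessThan_7 power2_eq_square)
  finally show ?thesis .
qed

text \<open>
The degrees that occur are 9 to 12, none of which is divisible by 7.
\<close>

lemma pair_sum_critical_cube:
  "pair_sum (\<lambda>x y. (relative_displacement (critical_mode q) x y) ^ 3) = 0"
proof -
  let ?h = quotient_poly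
  have "pair_sum (\<lambda>x y. (relative_displacement (critical_mode q) x y) ^ 3)
    = pair_sum (\<lambda>x y. q ^ 3 * (?h 4 x y * ?h 4 x y * ?h 4 x y) + 3 * q\<^sup>2 * cnj q * (?h 4 x y * ?h 4 x y * ?h 5 x y)
        + 3 * q * (cnj q)\<^sup>2 * (?h 4 x y * ?h 5 x y * ?h 5 x y) + cnj q ^ 3 * (?h 5 x y * ?h 5 x y * ?h 5 x y))"
    unfolding relative_displacement_critical_mode
    by (intro pair_sum_cong) (simp add: algebra_simps power2_eq_square power3_eq_cube)
  also have "\<dots> = 0"
    by (simp add: pair_sum_add pair_sum_mult_left pair_sum_homogeneous[OF homogeneous_quotient_poly3])
  finally show ?thesis .
qed

text \<open>
The square of the critical mode has terms of degrees 6, 7 and 8, so the degree of the product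
with mode \<open>m\<close> is a multiple of 7 only for \<open>q\<^sup>2\<close> with \<open>m = 2\<close> and for \<open>q * cnj q\<close> with \<open>m = 1\<close>. These are the
only modes that interact with the critical one at fourth order.
\<close>

lemma pair_sum_critical_sq_mult:
  "pair_sum (\<lambda>x y. (relative_displacement (critical_mode q) x y)\<^sup>2 * relative_displacement b x y)
    = - 126 * (q\<^sup>2 * b 2) - 84 * (q * cnj q * b 1)"
proof -
  let ?h = quotient_poly
  have "pair_sum (\<lambda>x y. (relative_displacement (critical_mode q) x y)\<^sup>2 * relative_displacement b x y)
    = pair_sum (\<lambda>x y. \<Sum>m<7. b m * (q\<^sup>2 * (?h 4 x y * ?h 4 x y * ?h m x y)
        + 2 * q * cnj q * (?h 4 x y * ?h 5 x y * ?h m x y) + (cnj q)\<^sup>2 * (?h 5 x y * ?h 5 x y * ?h m x y)))"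
    unfolding relative_displacement_critical_mode relative_displacement_def[of b] sum_distrib_left
    by (intro pair_sum_cong sum.cong refl) (simp add: algebra_simps power2_eq_square)
  also have "\<dots> = (\<Sum>m<7. b m * (q\<^sup>2 * pair_sum (\<lambda>x y. ?h 4 x y * ?h 4 x y * ?h m x y)
        + 2 * q * cnj q * pair_sum (\<lambda>x y. ?h 4 x y * ?h 5 x y * ?h m x y)
        + (cnj q)\<^sup>2 * pair_sum (\<lambda>x y. ?h 5 x y * ?h 5 x y * ?h m x y)))"
    by (simp only: pair_sum_sum pair_sum_mult_left pair_sum_add)
  also have "\<dots> = (\<Sum>m<7. b m * (q\<^sup>2 * (if m = 2 then - 126 else 0)
        + 2 * q * cnj q * (if m = 1 then - 42 else 0) + (cnj q)\<^sup>2 * 0))"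
  proof (intro sum.cong refl)
    fix m :: nat assume "m \<in> {..<7}"
    then have "m = 0 \<or> m = 1 \<or> m = 2 \<or> m = 3 \<or> m = 4 \<or> m = 5 \<or> m = 6" by auto
    then have m: "m = 0 \<or> m = 1 \<or> m = 2 \<or> m = 3 \<or> m = 4 \<or> m = 5 \<or> m = 6" .
    have "pair_sum (\<lambda>x y. ?h 4 x y * ?h 4 x y * ?h m x y) = (if m = 2 then - 126 else 0)"
    proof (cases "m = 2")
      case False
      with m show ?thesis
        by (elim disjE) (simp_all add: pair_sum_homogeneous[OF homogeneous_quotient_poly3] pair_sum_0)
    qed (use pair_sum_quotient_poly_442 in simp)
    moreover have "pair_sum (\<lambda>x y. ?h 4 x y * ?h 5 x y * ?h m x y) = (if m = 1 then - 42 else 0)"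
    proof (cases "m = 1")
      case True
      then show ?thesis using pair_sum_quotient_poly2[of 4 5] by (simp add: quotient_poly_Suc_0)
    next
      case False
      with m show ?thesis
        by (elim disjE) (simp_all add: pair_sum_homogeneous[OF homogeneous_quotient_poly3] pair_sum_0)
    qed
    moreover have "pair_sum (\<lambda>x y. ?h 5 x y * ?h 5 x y * ?h m x y) = 0"
      using m by (elim disjE) (simp_all add: pair_sum_homogeneous[OF homogeneous_quotient_poly3] pair_sum_0)
    ultimately show "b m * (q\<^sup>2 * pair_sum (\<lambda>x y. ?h 4 x y * ?h 4 x y * ?h m x y)
        + 2 * q * cnj q * pair_sum (\<lambda>x y. ?h 4 x y * ?h 5 x y * ?h m x y)
        + (cnj q)\<^sup>2 * pair_sum (\<lambda>x y. ?h 5 x y * ?h 5 x y * ?h m x y))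
      = b m * (q\<^sup>2 * (if m = 2 then - 126 else 0)
        + 2 * q * cnj q * (if m = 1 then - 42 else 0) + (cnj q)\<^sup>2 * 0)"
      by simp
  qed
  also have "\<dots> = - 126 * (q\<^sup>2 * b 2) - 84 * (q * cnj q * b 1)"
    by (simp add: lessThan_7)
  finally show ?thesis .
qed

text \<open>
Among the degrees 12 to 16 only 14 is a multiple of 7, and it belongs to \<open>(q * cnj q)\<^sup>2\<close>.
\<close>

lemma pair_sum_critical_fourth:
  "pair_sum (\<lambda>x y. (relative_displacement (critical_mode q) x y) ^ 4) = 1428 * (q * cnj q)\<^sup>2"
proof -
  let ?h = quotient_poly
  have binom: "(a + b) ^ 4 = a ^ 4 + 4 * (a ^ 3 * b) + 6 * (a\<^sup>2 * b\<^sup>2) + 4 * (a * b ^ 3) + b ^ 4"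
    for a b :: complex by algebra
  have "pair_sum (\<lambda>x y. (relative_displacement (critical_mode q) x y) ^ 4)
    = pair_sum (\<lambda>x y. q ^ 4 * (?h 4 x y * ?h 4 x y * ?h 4 x y * ?h 4 x y)
        + 4 * (q ^ 3 * cnj q) * (?h 4 x y * ?h 4 x y * ?h 4 x y * ?h 5 x y)
        + 6 * (q * cnj q)\<^sup>2 * (?h 4 x y * ?h 4 x y * ?h 5 x y * ?h 5 x y)
        + 4 * (q * cnj q ^ 3) * (?h 4 x y * ?h 5 x y * ?h 5 x y * ?h 5 x y)
        + cnj q ^ 4 * (?h 5 x y * ?h 5 x y * ?h 5 x y * ?h 5 x y))"
    unfolding relative_displacement_critical_mode binom
    by (intro pair_sum_cong) (simp add: power_mult_distrib power4_eq_xxxx power3_eq_cube power2_eq_square mult_ac)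
  also have "\<dots> = 1428 * (q * cnj q)\<^sup>2"
    using pair_sum_quotient_poly_4455
    by (simp add: pair_sum_add pair_sum_mult_left pair_sum_homogeneous[OF homogeneous_quotient_poly4])
  finally show ?thesis .
qed

section \<open>The heptagon as a strict local maximum\<close>

text \<open>
The difference of the logarithm and its Taylor polynomial has the derivative \<open>z ^ 4 / (1 + z)\<close>.
\<close>

lemma Ln_taylor4:
  assumes "cmod h \<le> 1 / 2"
  shows "cmod (Ln (1 + h) - (h - h\<^sup>2 / 2 + h ^ 3 / 3 - h ^ 4 / 4)) \<le> 2 * cmod h ^ 5"
proof -
  define f where "f h = Ln (1 + h) - (h - h\<^sup>2 / 2 + h ^ 3 / 3 - h ^ 4 / 4)" for h :: complex
  have "cmod (f h - f 0) \<le> 2 * cmod h ^ 4 * cmod (h - 0)"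
  proof (rule field_differentiable_bound[where S = "cball 0 (cmod h)" and f' = "\<lambda>z. z ^ 4 / (1 + z)"])
    fix z :: complex assume "z \<in> cball 0 (cmod h)"
    then have z: "cmod z \<le> cmod h" by simp
    then have "cmod z \<le> 1 / 2" using assms by linarith
    then have "Re z \<ge> - 1 / 2" using abs_Re_le_cmod[of z] by linarith
    then have "1 + z \<notin> \<real>\<^sub>\<le>\<^sub>0" by (auto simp: complex_nonpos_Reals_iff)
    then have nz: "1 + z \<noteq> 0" by auto
    have "((\<lambda>h. 1 + h) has_field_derivative 1) (at z)"
      by (auto intro!: derivative_eq_intros)
    from DERIV_chain2[OF has_field_derivative_Ln[OF \<open>1 + z \<notin> \<real>\<^sub>\<le>\<^sub>0\<close>] this]
    have Ln': "((\<lambda>h. Ln (1 + h)) has_field_derivative 1 / (1 + z)) (at z)"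
      by (simp add: inverse_eq_divide)
    have "((\<lambda>h. h - h\<^sup>2 / 2 + h ^ 3 / 3 - h ^ 4 / 4) has_field_derivative (1 - z + z\<^sup>2 - z ^ 3)) (at z)"
      by (auto intro!: derivative_eq_intros simp: power2_eq_square power3_eq_cube)
    from DERIV_diff[OF Ln' this]
    have "(f has_field_derivative 1 / (1 + z) - (1 - z + z\<^sup>2 - z ^ 3)) (at z)"
      unfolding f_def[abs_def] .
    moreover have "1 / (1 + z) - (1 - z + z\<^sup>2 - z ^ 3) = z ^ 4 / (1 + z)"
      using nz by (simp add: divide_simps) (simp add: algebra_simps eval_nat_numeral)
    ultimately show "(f has_field_derivative z ^ 4 / (1 + z)) (at z within cball 0 (cmod h))"
      by (simp add: has_field_derivative_at_within)
    have "1 / 2 \<le> cmod (1 + z)"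
      using norm_triangle_ineq4[of "1 + z" z] \<open>cmod z \<le> 1 / 2\<close> by simp
    then have "cmod (z ^ 4 / (1 + z)) \<le> cmod z ^ 4 / (1 / 2)"
      unfolding norm_divide norm_power by (intro frac_le) auto
    also have "\<dots> \<le> 2 * cmod h ^ 4"
      using power_mono[OF z, of 4] by simp
    finally show "cmod (z ^ 4 / (1 + z)) \<le> 2 * cmod h ^ 4" .
  qed auto
  then show ?thesis
    by (simp add: f_def eval_nat_numeral mult_ac)
qed

text \<open>
Here \<open>a\<close> has weight 1 and \<open>b\<close> weight 2. All terms of weight at most 4 are kept, and \<open>A ^ 4 + B\<^sup>2\<close> is the
size of weight 4, so the error carries an additional small factor \<open>s\<close>. The linear and
quadratic terms are kept unexpanded, as their pair sums are known exactly.
\<close>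

lemma Ln_split_expansion:
  assumes a: "cmod a \<le> A" and b: "cmod b \<le> B" and s: "A \<le> s" "B \<le> s" "s \<le> 1 / 4"
  shows "cmod (Ln (1 + (a + b)) - ((a + b) - (a + b)\<^sup>2 / 2 + a ^ 3 / 3 + a\<^sup>2 * b - a ^ 4 / 4))
    \<le> 70 * s * (A ^ 4 + B\<^sup>2)"
proof -
  have pos: "0 \<le> A" "0 \<le> B" using a b norm_ge_zero order_trans by blast+
  then have "0 \<le> s" using s by linarith
  let ?T = "\<lambda>h. h - h\<^sup>2 / 2 + h ^ 3 / 3 - h ^ 4 / 4"
  have ab: "cmod (a + b) \<le> A + B" using norm_triangle_ineq[of a b] a b by linarith
  have B2: "0 \<le> s * B\<^sup>2" "0 \<le> s * A ^ 4" using \<open>0 \<le> s\<close> by auto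
  have p1: "x * B\<^sup>2 \<le> s * B\<^sup>2" if "x \<le> s" for x using that by (rule mult_right_mono) simp
  have A1: "A \<le> 1" "B \<le> 1" using s by auto
  have "cmod (Ln (1 + (a + b)) - ?T (a + b)) \<le> 2 * cmod (a + b) ^ 5"
    using ab s by (intro Ln_taylor4) linarith
  also have "\<dots> \<le> 2 * (A + B) ^ 5"
    using power_mono[OF ab, of 5] by simp
  also have "\<dots> \<le> 64 * (s * (A ^ 4 + B\<^sup>2))"
  proof (cases "A \<le> B")
    case True
    then have "(A + B) ^ 5 \<le> (2 * B) ^ 5" using pos by (intro power_mono) auto
    also have "\<dots> = 32 * ((B\<^sup>2 * B) * B\<^sup>2)" by (simp add: eval_nat_numeral)
    also have "B\<^sup>2 * B \<le> 1 * B"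
      using pos A1 power_le_one[of B 2] by (intro mult_right_mono) auto
    then have "32 * ((B\<^sup>2 * B) * B\<^sup>2) \<le> 32 * (s * B\<^sup>2)"
      using p1[of "B\<^sup>2 * B"] s by simp
    finally show ?thesis using B2 by (simp add: algebra_simps)
  next
    case False
    then have "(A + B) ^ 5 \<le> (2 * A) ^ 5" using pos by (intro power_mono) auto
    also have "\<dots> = 32 * (A * A ^ 4)" by (simp add: eval_nat_numeral)
    also have "\<dots> \<le> 32 * (s * A ^ 4)" using s by (intro mult_left_mono mult_right_mono) auto
    finally show ?thesis using B2 by (simp add: algebra_simps)
  qed
  finally have 1: "cmod (Ln (1 + (a + b)) - ?T (a + b)) \<le> 64 * (s * (A ^ 4 + B\<^sup>2))" .
  \<comment> \<open>The terms of the Taylor polynomial that have weight 5 or more.\<close>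
  let ?R = "a * b\<^sup>2 + b ^ 3 / 3 - a ^ 3 * b - 3 / 2 * (a\<^sup>2 * b\<^sup>2) - a * b ^ 3 - b ^ 4 / 4"
  have R: "?T (a + b) - ((a + b) - (a + b)\<^sup>2 / 2 + a ^ 3 / 3 + a\<^sup>2 * b - a ^ 4 / 4) = ?R"
    by (simp add: field_simps eval_nat_numeral)
  have m: "cmod (a ^ i * b ^ j) \<le> A ^ i * B ^ j" for i j
    unfolding norm_mult norm_power using a b pos by (intro mult_mono power_mono) auto
  have "cmod ?R \<le> cmod (a * b\<^sup>2) + cmod (b ^ 3 / 3) + cmod (a ^ 3 * b) + cmod (3 / 2 * (a\<^sup>2 * b\<^sup>2))
      + cmod (a * b ^ 3) + cmod (b ^ 4 / 4)"
    by (intro order_trans[OF norm_triangle_ineq4] order_trans[OF norm_triangle_ineq] add_mono order_refl)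
  also have "\<dots> \<le> A * B\<^sup>2 + B ^ 3 / 3 + A ^ 3 * B + 3 / 2 * (A\<^sup>2 * B\<^sup>2) + A * B ^ 3 + B ^ 4 / 4"
    using m[of 1 2] m[of 0 3] m[of 3 1] m[of 2 2] m[of 1 3] m[of 0 4]
    by (intro add_mono) (simp_all add: norm_mult norm_divide)
  also have "\<dots> \<le> 6 * (s * (A ^ 4 + B\<^sup>2))"
  proof -
    have "B ^ 3 \<le> s * B\<^sup>2" using p1[of B] s by (simp add: power3_eq_cube power2_eq_square)
    moreover have "A * B ^ 3 \<le> s * B\<^sup>2"
      using p1[of "A * B"] s mult_mono[of A 1 B s] A1 pos by (simp add: power3_eq_cube power2_eq_square mult_ac)
    moreover have "B ^ 4 \<le> s * B\<^sup>2"
      using p1[of "B * B"] s mult_mono[of B 1 B s] A1 pos by (simp add: power4_eq_xxxx power2_eq_square mult_ac)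
    moreover have "A\<^sup>2 * B\<^sup>2 \<le> s * B\<^sup>2"
      using p1[of "A * A"] s mult_mono[of A 1 A s] A1 pos by (simp add: power2_eq_square mult_ac)
    moreover have "A ^ 3 * B \<le> s * (A ^ 4 + B\<^sup>2)"
    proof -
      have "A\<^sup>2 * B \<le> A ^ 4 + B\<^sup>2"
      proof -
        have "2 * (A\<^sup>2 * B) \<le> (A\<^sup>2)\<^sup>2 + B\<^sup>2" using sum_squares_bound[of "A\<^sup>2" B] by simp
        moreover have "0 \<le> A\<^sup>2 * B" using pos by simp
        moreover have "(A\<^sup>2)\<^sup>2 = A ^ 4" by simp
        ultimately show ?thesis by linarith
      qed
      then have "A * (A\<^sup>2 * B) \<le> s * (A ^ 4 + B\<^sup>2)"
        using pos s by (intro mult_mono) auto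
      then show ?thesis by (simp add: power3_eq_cube power2_eq_square mult_ac)
    qed
    moreover have "A * B\<^sup>2 \<le> s * B\<^sup>2" using p1 s by simp
    ultimately show ?thesis using B2 by (simp add: algebra_simps)
  qed
  finally have 2: "cmod ?R \<le> 6 * (s * (A ^ 4 + B\<^sup>2))" .
  have "cmod (Ln (1 + (a + b)) - ((a + b) - (a + b)\<^sup>2 / 2 + a ^ 3 / 3 + a\<^sup>2 * b - a ^ 4 / 4))
     \<le> cmod (Ln (1 + (a + b)) - ?T (a + b)) + cmod ?R"
    unfolding R[symmetric] by (rule order_trans[OF _ norm_triangle_ineq]) (simp add: algebra_simps)
  then show ?thesis using 1 2 by (simp add: algebra_simps)
qed

text \<open>
Completing the squares of \<open>\<beta>\<close> and \<open>n2\<close> after one unit of each diagonal term is set aside: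
\<open>1764 / 41 + 3969 / 20 < 257 = 357 - 100\<close>.
\<close>

lemma reduced_form_negative:
  fixes Q \<beta> n0 n2 n3 n6 p :: real
  shows "- 42 * \<beta>\<^sup>2 - 84 * Q * \<beta> + 126 * Q * n2 - 21 * n2\<^sup>2 - 357 * Q\<^sup>2 - 21 * n0\<^sup>2 + 28 * (n3 * n6)
      - 21 * n3\<^sup>2 - 21 * n6\<^sup>2 - 84 * p\<^sup>2
    \<le> - (n0\<^sup>2 + \<beta>\<^sup>2 + n2\<^sup>2 + n3\<^sup>2 + n6\<^sup>2 + p\<^sup>2) - 100 * Q\<^sup>2"
proof -
  have "0 \<le> 41 * (\<beta> + 42 / 41 * Q)\<^sup>2" "0 \<le> 20 * (n2 - 63 / 20 * Q)\<^sup>2" "0 \<le> 14 * (n3 - n6)\<^sup>2"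
    by simp_all
  moreover have "41 * (\<beta> + 42 / 41 * Q)\<^sup>2 = 41 * \<beta>\<^sup>2 + 84 * Q * \<beta> + 1764 / 41 * Q\<^sup>2"
    "20 * (n2 - 63 / 20 * Q)\<^sup>2 = 20 * n2\<^sup>2 - 126 * Q * n2 + 3969 / 20 * Q\<^sup>2"
    "14 * (n3 - n6)\<^sup>2 = 14 * n3\<^sup>2 - 28 * (n3 * n6) + 14 * n6\<^sup>2"
    by (simp_all add: power2_eq_square field_simps)
  moreover have "0 \<le> n0\<^sup>2" "0 \<le> n3\<^sup>2" "0 \<le> n6\<^sup>2" "0 \<le> p\<^sup>2" "0 \<le> Q\<^sup>2" by simp_all
  ultimately show ?thesis by linarith
qed

text \<open>
The analytic core. The perturbation is split into its critical part, with amplitude \<open>q\<close>, and the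
rest; \<open>p\<close> is the component of the modes 4 and 5 that is transversal to the kernel. In the
difference of the two sides the terms of weight at most 4 are bounded by \<open>- P - 100 Q\<^sup>2\<close> with \<open>Q = |q|\<^sup>2\<close> and \<open>P\<close> the squared size of the
rest, and the error is a small multiple of \<open>P + Q\<^sup>2\<close>. The hypothesis \<open>Im (b 1) = 0\<close> excludes the
direction of rotation.
\<close>

lemma heptagon_log_estimate:
  fixes b :: "nat \<Rightarrow> complex"
  assumes small: "\<And>m. m < 7 \<Longrightarrow> cmod (b m) \<le> 1 / 10 ^ 9" and real: "Im (b 1) = 0"
    and nontrivial: "m0 < 7" "b m0 \<noteq> 0"
  shows "pair_sum (\<lambda>x y. ln (cmod (1 + relative_displacement b x y)))
    < 21 * (2 * Re (b 1) + (\<Sum>m<7. (cmod (b m))\<^sup>2))"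
proof -
  define q where "q = (b 4 + cnj (b 5)) / 2"
  define p where "p = (b 4 - cnj (b 5)) / 2"
  define d where "d m = b m - critical_mode q m" for m
  define K where "K = relative_displacement (critical_mode q)"
  define D where "D = relative_displacement d"
  define A where "A = 9 * cmod q"
  define B where "B = cmod (b 1) + 2 * cmod (b 2) + 3 * cmod (b 3) + 9 * cmod p + 6 * cmod (b 6)"
  \<comment> \<open>The error bound is \<open>42 * 70 * s * (6561 * Q\<^sup>2 + 441 * P)\<close>, so \<open>s\<close> must be below \<open>1 / (2940 * 441)\<close>.\<close>
  define s :: real where "s = 1 / 10 ^ 7"
  define P where "P = (cmod (b 0))\<^sup>2 + (Re (b 1))\<^sup>2 + (cmod (b 2))\<^sup>2 + (cmod (b 3))\<^sup>2 + (cmod (b 6))\<^sup>2 + (cmod p)\<^sup>2"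
  define Q where "Q = (cmod q)\<^sup>2"
  \<comment> \<open>The quadratic part of \<open>\<Lambda>\<close> is \<open>- 84 |p|\<^sup>2\<close> on the modes 4 and 5.\<close>
  have b4: "b 4 = q + p" and b5: "b 5 = cnj (q - p)"
    by (simp_all add: q_def p_def field_simps complex_eq_iff)
  have d: "d 0 = b 0" "d 1 = b 1" "d 2 = b 2" "d 3 = b 3" "d 4 = p" "d 5 = - cnj p" "d 6 = b 6"
    by (simp_all add: d_def critical_mode_def b4 b5)
  have H: "relative_displacement b x y = K x y + D x y" for x y
    by (simp add: K_def D_def relative_displacement_def sum.distrib[symmetric] d_def algebra_simps)
  have K_le: "cmod (K x y) \<le> A" if "x \<in> roots7" "y \<in> roots7" for x y
    using cmod_relative_displacement_le[OF that, of "critical_mode q"]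
    by (simp add: K_def A_def critical_mode_def lessThan_7)
  have D_le: "cmod (D x y) \<le> B" if "x \<in> roots7" "y \<in> roots7" for x y
    using cmod_relative_displacement_le[OF that, of d] d by (simp add: D_def B_def lessThan_7)
  have "2 * cmod q \<le> cmod (b 4) + cmod (b 5)" "2 * cmod p \<le> cmod (b 4) + cmod (b 5)"
    using norm_triangle_ineq[of "b 4" "cnj (b 5)"] norm_triangle_ineq4[of "b 4" "cnj (b 5)"]
    by (simp_all add: q_def p_def norm_divide)
  moreover have "cmod (b 4) \<le> 1 / 10 ^ 9" "cmod (b 5) \<le> 1 / 10 ^ 9"
    by (rule small, simp)+
  ultimately have qp: "cmod q \<le> 1 / 10 ^ 9" "cmod p \<le> 1 / 10 ^ 9"
    by linarith+
  have As: "A \<le> s" using qp by (simp add: A_def s_def)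
  have Bs: "B \<le> s"
    using qp small[of 1] small[of 2] small[of 3] small[of 6] by (simp add: B_def s_def)
  have s4: "s \<le> 1 / 4" by (simp add: s_def)
  define E where "E = 70 * s * (A ^ 4 + B\<^sup>2)"
  define T where "T x y = relative_displacement b x y - 1 / 2 * (relative_displacement b x y)\<^sup>2
      + 1 / 3 * K x y ^ 3 + (K x y)\<^sup>2 * D x y - 1 / 4 * K x y ^ 4" for x y
  have "ln (cmod (1 + relative_displacement b x y)) - Re (T x y) \<le> E"
    if xy: "x \<in> roots7" "y \<in> roots7" for x y
  proof -
    have "cmod (K x y + D x y) \<le> 1 / 2"
      using norm_triangle_ineq[of "K x y" "D x y"] K_le[OF xy] D_le[OF xy] As Bs s4 by linarith
    then have "1 + (K x y + D x y) \<noteq> 0"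
      by (metis add_eq_0_iff norm_minus_cancel norm_one not_le one_less_numeral_iff semiring_norm(76)
          divide_less_eq_1_pos zero_less_numeral)
    then have "ln (cmod (1 + relative_displacement b x y)) - Re (T x y) = Re (Ln (1 + (K x y + D x y)) - T x y)"
      by (simp add: H)
    also have "\<dots> \<le> cmod (Ln (1 + (K x y + D x y)) - T x y)" by (rule complex_Re_le_cmod)
    also have "\<dots> \<le> E"
      using Ln_split_expansion[OF K_le[OF xy] D_le[OF xy] As Bs s4] by (simp add: T_def H E_def)
    finally show ?thesis .
  qed
  then have "pair_sum (\<lambda>x y. ln (cmod (1 + relative_displacement b x y)) - Re (T x y)) \<le> 42 * E"
    by (rule pair_sum_bound)
  then have le: "pair_sum (\<lambda>x y. ln (cmod (1 + relative_displacement b x y))) \<le> Re (pair_sum T) + 42 * E"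
    by (simp add: pair_sum_diff Re_pair_sum)
  have qq: "q * cnj q = of_real Q"
    unfolding Q_def by (rule complex_norm_square[symmetric])
  have "pair_sum T = 42 * b 1 - 1 / 2 * (42 * (b 1)\<^sup>2 - 56 * (b 3 * b 6) - 84 * (b 4 * b 5))
      + 1 / 3 * 0 + (- 126 * (q\<^sup>2 * d 2) - 84 * (q * cnj q * d 1)) - 1 / 4 * (1428 * (q * cnj q)\<^sup>2)"
    unfolding T_def[abs_def] K_def D_def
    by (simp only: pair_sum_add pair_sum_diff pair_sum_mult_left pair_sum_relative_displacement
        pair_sum_relative_displacement_sq pair_sum_critical_cube pair_sum_critical_sq_mult pair_sum_critical_fourth)
  also have "\<dots> = 42 * b 1 - 21 * (b 1)\<^sup>2 + 28 * (b 3 * b 6) + 42 * (b 4 * b 5) - 126 * (q\<^sup>2 * b 2)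
      - of_real (84 * Q) * b 1 - of_real (357 * Q\<^sup>2)"
    unfolding qq d by (simp add: algebra_simps)
  finally have Re_T: "Re (pair_sum T) = 42 * Re (b 1) - 21 * (Re (b 1))\<^sup>2 + 28 * Re (b 3 * b 6) + 42 * Re (b 4 * b 5)
      - 126 * Re (q\<^sup>2 * b 2) - 84 * Q * Re (b 1) - 357 * Q\<^sup>2"
    using real by (simp add: power2_eq_square)
  have Re36: "Re (b 3 * b 6) \<le> cmod (b 3) * cmod (b 6)"
    using complex_Re_le_cmod[of "b 3 * b 6"] by (simp add: norm_mult)
  have Re2: "- Re (q\<^sup>2 * b 2) \<le> Q * cmod (b 2)"
    using abs_Re_le_cmod[of "q\<^sup>2 * b 2"] by (simp add: Q_def norm_mult norm_power)
  have Re45: "Re (b 4 * b 5) = Q - (cmod p)\<^sup>2" and norm45: "(cmod (b 4))\<^sup>2 + (cmod (b 5))\<^sup>2 = 2 * Q + 2 * (cmod p)\<^sup>2"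
    unfolding b4 b5 Q_def cmod_power2 by (simp_all add: power2_eq_square algebra_simps)
  have norm1: "(cmod (b 1))\<^sup>2 = (Re (b 1))\<^sup>2"
    using real by (simp add: cmod_power2)
  have sum7: "(\<Sum>m<7. (cmod (b m))\<^sup>2) = (cmod (b 0))\<^sup>2 + (Re (b 1))\<^sup>2 + (cmod (b 2))\<^sup>2 + (cmod (b 3))\<^sup>2
      + (2 * Q + 2 * (cmod p)\<^sup>2) + (cmod (b 6))\<^sup>2"
    unfolding norm45[symmetric] norm1[symmetric] lessThan_7 by simp
  have "Re (pair_sum T) - 21 * (2 * Re (b 1) + (\<Sum>m<7. (cmod (b m))\<^sup>2)) \<le> - P - 100 * Q\<^sup>2"
    using reduced_form_negative[of "Re (b 1)" Q "cmod (b 2)" "cmod (b 0)" "cmod (b 3)" "cmod (b 6)" "cmod p"]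
      Re36 Re2 unfolding Re_T Re45 sum7 P_def by (simp add: algebra_simps)
  moreover have "42 * E < P + 100 * Q\<^sup>2"
  proof -
    have "P \<ge> 0" by (simp add: P_def)
    have le_P: "x \<le> sqrt P" if "x\<^sup>2 \<le> P" for x using that by (rule real_le_rsqrt)
    have "cmod (b 1) \<le> sqrt P" "cmod (b 2) \<le> sqrt P" "cmod (b 3) \<le> sqrt P" "cmod p \<le> sqrt P" "cmod (b 6) \<le> sqrt P"
      by (rule le_P, simp add: P_def norm1 del: One_nat_def)+
    then have "B \<le> 21 * sqrt P" unfolding B_def by linarith
    then have "B\<^sup>2 \<le> (21 * sqrt P)\<^sup>2" by (intro power_mono) (auto simp: B_def)
    also have "\<dots> = 441 * P" using \<open>P \<ge> 0\<close> by (simp add: power_mult_distrib)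
    finally have B2: "B\<^sup>2 \<le> 441 * P" .
    have A4: "A ^ 4 = 6561 * Q\<^sup>2" by (simp add: A_def Q_def power_mult_distrib)
    have "P > 0 \<or> Q > 0"
    proof (rule ccontr)
      assume "\<not> (P > 0 \<or> Q > 0)"
      then have "P = 0" "q = 0" using \<open>P \<ge> 0\<close> by (auto simp: Q_def)
      moreover have "0 \<le> (cmod (b 0))\<^sup>2" "0 \<le> (Re (b 1))\<^sup>2" "0 \<le> (cmod (b 2))\<^sup>2" "0 \<le> (cmod (b 3))\<^sup>2"
        "0 \<le> (cmod (b 6))\<^sup>2" "0 \<le> (cmod p)\<^sup>2" by simp_all
      ultimately have "(cmod (b 0))\<^sup>2 = 0" "(cmod (b 1))\<^sup>2 = 0" "(cmod (b 2))\<^sup>2 = 0" "(cmod (b 3))\<^sup>2 = 0"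
        "(cmod (b 6))\<^sup>2 = 0" "(cmod p)\<^sup>2 = 0"
        unfolding P_def norm1 by linarith+
      then have "b 0 = 0" "b 1 = 0" "b 2 = 0" "b 3 = 0" "b 4 = 0" "b 5 = 0" "b 6 = 0"
        using \<open>q = 0\<close> by (auto simp: b4 b5)
      moreover have "m0 \<in> {0, 1, 2, 3, 4, 5, 6}" using nontrivial(1) lessThan_7 by blast
      ultimately show False using nontrivial(2) by auto
    qed
    then have "P > 0 \<or> Q\<^sup>2 > 0" by auto
    moreover have "42 * E \<le> 2940 * s * (6561 * Q\<^sup>2 + 441 * P)"
      unfolding E_def A4 using B2 by (simp add: s_def)
    then have "21000000 * E \<le> 964467 * Q\<^sup>2 + 64827 * P"
      by (simp add: s_def)
    moreover have "Q\<^sup>2 \<ge> 0" by simp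
    ultimately show ?thesis using \<open>P \<ge> 0\<close> by linarith
  qed
  ultimately show ?thesis using le by linarith
qed

lemma sum_off_diagonal_eq_pair_sum:
  assumes "bij_betw e UNIV roots7"
  shows "(\<Sum>i\<in>UNIV. \<Sum>j\<in>- {i}. F (e i) (e j)) = pair_sum F"
proof -
  have "(\<Sum>j\<in>- {i}. F (e i) (e j)) = (\<Sum>y\<in>roots7 - {e i}. F (e i) y)" for i
    by (rule sum.reindex_bij_betw) (use assms in \<open>auto simp: bij_betw_def inj_on_def\<close>)
  then show ?thesis
    unfolding pair_sum_def using sum.reindex_bij_betw[OF assms, of "\<lambda>x. \<Sum>y\<in>roots7 - {x}. F x y"] by simp
qed

text \<open>
Discrete Fourier analysis of \<open>z / r\<close> yields the coefficients \<open>b\<close>; the logarithmic part of \<open>\<Lambda>\<close> turns into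
the pair sum of \<open>heptagon_log_estimate\<close> and, by Parseval, the moment of inertia into
\<open>7 r\<^sup>2 (1 + 2 Re b\<^sub>1 + \<Sum>m. |b\<^sub>m|\<^sup>2)\<close>.
\<close>

lemma heptagon_strict_local_max:
  fixes z z0 :: "complex ^ 7"
  assumes r: "r > 0" and e: "bij_betw e UNIV roots7" and z0: "\<And>j. z0 $ j = complex_of_real r * e j"
    and near: "norm (z - z0) \<le> r / 10 ^ 9" and aligned: "Im (hermitian z0 z) = 0" and "z \<noteq> z0"
  shows "augmented_energy (3 / r\<^sup>2) z < augmented_energy (3 / r\<^sup>2) z0"
proof -
  have close: "cmod (z $ j - z0 $ j) \<le> r / 10 ^ 9" for j
    using Finite_Cartesian_Product.norm_nth_le[of "z - z0" j] near by simp
  define f where "f x = z $ (inv e x) / complex_of_real r - x" for x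
  define b where "b m = (\<Sum>y\<in>roots7. f y * cnj y ^ m) / 7" for m
  have e_roots: "e j \<in> roots7" for j using e by (auto simp: bij_betw_def)
  have inv_e: "inv e (e j) = j" for j using e by (simp add: bij_betw_def)
  have f_e: "f (e j) = (z $ j - z0 $ j) / complex_of_real r" for j
    using r by (simp add: f_def inv_e z0 diff_divide_distrib)
  have sum_roots: "(\<Sum>y\<in>roots7. g y) = (\<Sum>j\<in>UNIV. g (e j))" for g :: "complex \<Rightarrow> 'a::comm_monoid_add"
    using sum.reindex_bij_betw[OF e, of g] by simp
  have fourier: "f x = (\<Sum>m<7. b m * x ^ m)" if "x \<in> roots7" for x
    unfolding b_def by (rule fourier_inversion[OF that])
  have z_eq: "z $ j = complex_of_real r * (e j + (\<Sum>m<7. b m * e j ^ m))" for j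
    using r by (simp add: fourier[OF e_roots, symmetric] f_e distrib_left) (simp add: z0)
  have small: "cmod (b m) \<le> 1 / 10 ^ 9" for m
  proof -
    have "cmod (\<Sum>y\<in>roots7. f y * cnj y ^ m) \<le> (\<Sum>y\<in>roots7. 1 / 10 ^ 9)"
    proof (rule sum_norm_le)
      fix y assume y: "y \<in> roots7"
      then obtain j where j: "y = e j" using e by (auto simp: bij_betw_def)
      have "cmod (f y) \<le> 1 / 10 ^ 9"
        using close[of j] r by (simp add: j f_e norm_divide divide_simps)
      then show "cmod (f y * cnj y ^ m) \<le> 1 / 10 ^ 9"
        using cmod_roots7[OF y] by (simp add: norm_mult norm_power)
    qed
    then show ?thesis using card_roots_unity_eq[of 7] by (simp add: b_def norm_divide)
  qed
  have Im_b1: "Im (b 1) = 0"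
  proof -
    have "f (e j) * cnj (e j) = cnj (z0 $ j) * z $ j / complex_of_real (r\<^sup>2) - 1" for j
      using r cmod_roots7[OF e_roots[of j]] complex_norm_square[of "e j"]
      by (simp add: f_e z0 field_simps power2_eq_square)
    then have "b 1 = ((\<Sum>j\<in>UNIV. cnj (z0 $ j) * z $ j) / complex_of_real (r\<^sup>2) - 7) / 7"
      by (simp add: b_def sum_roots sum_subtractf sum_divide_distrib)
    moreover obtain t where "(\<Sum>j\<in>UNIV. cnj (z0 $ j) * z $ j) = complex_of_real t"
      using aligned complex_is_Real_iff unfolding hermitian_def by (metis Reals_cases)
    ultimately have "b 1 = complex_of_real ((t / r\<^sup>2 - 7) / 7)" by simp
    then show ?thesis by (simp only: Im_complex_of_real)
  qed
  have "\<exists>m<7. b m \<noteq> 0"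
  proof (rule ccontr)
    assume "\<not> (\<exists>m<7. b m \<noteq> 0)"
    then have "z = z0" by (simp add: vec_eq_iff z_eq z0)
    then show False using \<open>z \<noteq> z0\<close> by simp
  qed
  then obtain m0 where m0: "m0 < 7" "b m0 \<noteq> 0" by blast
  let ?H = "relative_displacement b"
  have diff: "z $ i - z $ j = (z0 $ i - z0 $ j) * (1 + ?H (e i) (e j))" for i j
    using relative_displacement_mult_diff[of "e i" "e j" b]
    by (simp add: z_eq z0 distrib_left right_diff_distrib[symmetric] mult.assoc)
      (simp add: algebra_simps)
  have H_nz: "1 + ?H (e i) (e j) \<noteq> 0" for i j
  proof -
    have "cmod (?H (e i) (e j)) \<le> (\<Sum>m<7. real m * cmod (b m))"
      by (rule cmod_relative_displacement_le[OF e_roots e_roots])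
    also have "\<dots> \<le> (\<Sum>m<7. real m * (1 / 10 ^ 9))"
      using small by (intro sum_mono mult_left_mono) auto
    also have "\<dots> < 1" by (simp add: lessThan_7)
    finally show ?thesis by (metis add_eq_0_iff less_irrefl norm_minus_cancel norm_one)
  qed
  have z0_nz: "z0 $ i - z0 $ j \<noteq> 0" if "j \<in> - {i}" for i j
    using that r e by (auto simp: z0 bij_betw_def inj_eq)
  have ordered: "2 * log_distance_sum w = (\<Sum>i\<in>UNIV. \<Sum>j\<in>- {i}. ln ((cmod (w $ i - w $ j))\<^sup>2))" for w :: "complex ^ 7"
    unfolding log_distance_sum_def by (rule sum_unordered_pairs) (simp add: norm_minus_commute)
  have "2 * log_distance_sum z = (\<Sum>i\<in>UNIV. \<Sum>j\<in>- {i}. ln ((cmod (z0 $ i - z0 $ j))\<^sup>2) + 2 * ln (cmod (1 + ?H (e i) (e j))))"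
    unfolding ordered
  proof (intro sum.cong refl)
    fix i j :: 7 assume "j \<in> - {i}"
    then show "ln ((cmod (z $ i - z $ j))\<^sup>2) = ln ((cmod (z0 $ i - z0 $ j))\<^sup>2) + 2 * ln (cmod (1 + ?H (e i) (e j)))"
      using z0_nz H_nz by (simp add: diff norm_mult ln_mult_pos ln_realpow)
  qed
  also have "\<dots> = 2 * log_distance_sum z0 + 2 * (\<Sum>i\<in>UNIV. \<Sum>j\<in>- {i}. ln (cmod (1 + ?H (e i) (e j))))"
    unfolding ordered by (simp only: sum.distrib sum_distrib_left)
  finally have log: "log_distance_sum z = log_distance_sum z0 + pair_sum (\<lambda>x y. ln (cmod (1 + ?H x y)))"
    using sum_off_diagonal_eq_pair_sum[OF e, of "\<lambda>x y. ln (cmod (1 + ?H x y))"] by simp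
  \<comment> \<open>The coefficients of the perturbed configuration itself, the unperturbed one being \<open>x ^ 1\<close>.\<close>
  define c where "c = b(1 := 1 + b 1)"
  have c: "x + (\<Sum>m<7. b m * x ^ m) = (\<Sum>m<7. c m * x ^ m)" for x
    by (simp add: c_def lessThan_7 algebra_simps)
  have "(norm z)\<^sup>2 = r\<^sup>2 * (\<Sum>x\<in>roots7. (cmod (\<Sum>m<7. c m * x ^ m))\<^sup>2)"
  proof -
    have "(cmod (z $ j))\<^sup>2 = r\<^sup>2 * (cmod (\<Sum>m<7. c m * e j ^ m))\<^sup>2" for j
      unfolding z_eq c norm_mult power_mult_distrib by simp
    then show ?thesis by (simp add: norm_vec_sq sum_roots sum_distrib_left)
  qed
  also have "\<dots> = r\<^sup>2 * (7 * (\<Sum>m<7. (cmod (c m))\<^sup>2))"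
    by (simp only: parseval_roots7)
  also have "(\<Sum>m<7. (cmod (c m))\<^sup>2) = 1 + 2 * Re (b 1) + (\<Sum>m<7. (cmod (b m))\<^sup>2)"
    by (simp add: c_def lessThan_7 cmod_power2) (simp add: power2_eq_square algebra_simps)
  finally have norm_z: "(norm z)\<^sup>2 = 7 * r\<^sup>2 + r\<^sup>2 * (7 * (2 * Re (b 1) + (\<Sum>m<7. (cmod (b m))\<^sup>2)))"
    by (simp add: algebra_simps)
  have norm_z0: "(norm z0)\<^sup>2 = 7 * r\<^sup>2"
    using r cmod_roots7[OF e_roots] by (simp add: norm_vec_sq z0 norm_mult power_mult_distrib)
  have "augmented_energy (3 / r\<^sup>2) z - augmented_energy (3 / r\<^sup>2) z0
    = pair_sum (\<lambda>x y. ln (cmod (1 + ?H x y))) - 21 * (2 * Re (b 1) + (\<Sum>m<7. (cmod (b m))\<^sup>2))"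
    unfolding augmented_energy_def log norm_z norm_z0 using r by (simp add: field_simps)
  also have "\<dots> < 0"
    using heptagon_log_estimate[OF small Im_b1 m0] by simp
  finally show ?thesis by simp
qed

section \<open>The rotating heptagon\<close>

text \<open>
Counting replaces any analysis of the index type: all seven roots occur among the vertices, so
the seven indices enumerate them bijectively.
\<close>

lemma regular_heptagon_vertices:
  assumes "r > 0" and "regular_heptagon r z"
  obtains e where "bij_betw e UNIV roots7" and "\<And>j. z $ j = complex_of_real r * e j"
proof -
  define e where "e j = z $ j / complex_of_real r" for j
  have "roots7 \<subseteq> range e"
  proof
    fix x :: complex assume "x \<in> roots7"
    then obtain k where k: "k < 7" "x = cis (2 * pi * real k / 7)"
      using bij_betw_imp_surj_on[OF Complex.bij_betw_roots_unity[of 7]] by auto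
    \<comment> \<open>The indices run from 1 to 7, and the exponent 0 corresponds to the index 7.\<close>
    define j where "j = (if k = 0 then 7 else k)"
    have "x = cis (2 * pi * real j / 7)" using k by (simp add: j_def)
    also have "\<dots> = exp (2 * pi * \<i> * of_nat j / 7)"
      by (simp add: cis_conv_exp mult_ac)
    also have "\<dots> = e (of_nat j)"
      using assms k by (simp add: regular_heptagon_def e_def j_def)
    finally show "x \<in> range e" by blast
  qed
  moreover have "card (range e) \<le> card roots7"
    using card_image_le[of "UNIV :: 7 set" e] card_roots_unity_eq[of 7] by simp
  ultimately have range: "range e = roots7"
    by (metis card_seteq finite_class.finite_UNIV finite_imageI)
  then have "inj e"
    using card_roots_unity_eq[of 7] by (intro eq_card_imp_inj_on) auto
  show ?thesis
  proof
    show "bij_betw e UNIV roots7" using \<open>inj e\<close> range by (simp add: bij_betw_def)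
    show "z $ j = complex_of_real r * e j" for j using \<open>r > 0\<close> by (simp add: e_def)
  qed
qed

text \<open>
Pairing \<open>u\<close> with \<open>1 / u\<close> gives \<open>1 / (1 - u) + 1 / (1 - 1 / u) = 1\<close>, so the six terms for \<open>x = 1\<close> add up to 3.
\<close>

lemma sum_inverse_difference_roots7:
  assumes x: "x \<in> roots7"
  shows "(\<Sum>y\<in>roots7 - {x}. 1 / (x - y)) = 3 / x"
proof -
  let ?T = "\<Sum>u\<in>roots7 - {1::complex}. 1 / (1 - u)"
  have "?T = (\<Sum>u\<in>roots7 - {1}. 1 / (1 - 1 / u))"
    by (rule sum.reindex_bij_witness[of _ "\<lambda>u. 1 / u" "\<lambda>u. 1 / u"]) (auto simp: power_one_over)
  then have "?T + ?T = (\<Sum>u\<in>roots7 - {1}. 1 / (1 - u) + 1 / (1 - 1 / u))"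
    by (simp add: sum.distrib)
  also have "\<dots> = (\<Sum>u\<in>roots7 - {1::complex}. 1)"
  proof (intro sum.cong refl)
    fix u :: complex assume "u \<in> roots7 - {1}"
    then have "u \<noteq> 0" "1 - u \<noteq> 0" "u - 1 \<noteq> 0" by auto
    then have "1 / (1 - 1 / u) = - (u / (1 - u))"
      by (simp add: divide_simps) (simp add: algebra_simps)
    then show "1 / (1 - u) + 1 / (1 - 1 / u) = 1"
      using \<open>1 - u \<noteq> 0\<close> by (simp add: diff_divide_distrib[symmetric])
  qed
  also have "\<dots> = 6" using card_roots_unity_eq[of 7] by simp
  finally have T: "?T = 3" by simp
  have "(\<Sum>y\<in>roots7 - {x}. 1 / (x - y)) = (\<Sum>u\<in>roots7 - {1}. 1 / x * (1 / (1 - u)))"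
  proof (rule sum.reindex_bij_witness[of _ "\<lambda>u. x * u" "\<lambda>y. y / x"])
    fix y assume "y \<in> roots7 - {x}"
    have "x - y = x * (1 - y / x)" using roots7_nonzero[OF x] by (simp add: right_diff_distrib)
    then show "1 / x * (1 / (1 - y / x)) = 1 / (x - y)" by simp
  qed (use x roots7_nonzero[OF x] in \<open>auto simp: power_mult_distrib power_divide\<close>)
  also have "\<dots> = 3 / x" unfolding sum_distrib_left[symmetric] T by simp
  finally show ?thesis .
qed

lemma rotate_config_eq: "rotate_config \<theta> z = cos \<theta> *\<^sub>R z + sin \<theta> *\<^sub>R (\<chi> j. \<i> * z $ j)"
  by (simp add: vec_eq_iff complex_eq_iff)

lemma has_vector_derivative_rotate_config:
  "((\<lambda>t. rotate_config (\<Omega> * t) z) has_vector_derivative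
    (\<chi> j. \<i> * complex_of_real \<Omega> * rotate_config (\<Omega> * t) z $ j)) (at t)"
proof -
  let ?w = "\<chi> j. \<i> * z $ j"
  have "((\<lambda>t. cos (\<Omega> * t) *\<^sub>R z + sin (\<Omega> * t) *\<^sub>R ?w) has_vector_derivative
      (- (sin (\<Omega> * t) * \<Omega>)) *\<^sub>R z + (cos (\<Omega> * t) * \<Omega>) *\<^sub>R ?w) (at t)"
    by (auto intro!: derivative_eq_intros)
  moreover have "(- (sin (\<Omega> * t) * \<Omega>)) *\<^sub>R z + (cos (\<Omega> * t) * \<Omega>) *\<^sub>R ?w
      = (\<chi> j. \<i> * complex_of_real \<Omega> * rotate_config (\<Omega> * t) z $ j)"
    by (simp add: vec_eq_iff complex_eq_iff algebra_simps)
  ultimately show ?thesis by (simp only: rotate_config_eq)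
qed

text \<open>
By \<open>sum_inverse_difference_roots7\<close> the velocity of each vortex is \<open>\<i> \<Omega>\<close> times its position.
\<close>

lemma heptagon_relative_equilibrium:
  fixes z0 :: "complex ^ 7"
  assumes "\<kappa> \<noteq> 0" and r: "r > 0" and e: "bij_betw e UNIV roots7" and z0: "\<And>j. z0 $ j = complex_of_real r * e j"
  defines "\<Omega> \<equiv> 3 * \<kappa> / (4 * pi * r\<^sup>2)"
  shows "relative_equilibrium \<kappa> (\<lambda>t. rotate_config (\<Omega> * t) z0)"
proof -
  have e_roots: "e j \<in> roots7" for j using e by (auto simp: bij_betw_def)
  have e_nz: "e j \<noteq> 0" for j using roots7_nonzero[OF e_roots] .
  have velocity: "velocity \<kappa> (rotate_config \<theta> z0) = (\<chi> j. \<i> * complex_of_real \<Omega> * rotate_config \<theta> z0 $ j)" for \<theta>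
  proof -
    have S: "inverse_difference_sum (rotate_config \<theta> z0) j = 3 / (cis \<theta> * complex_of_real r * e j)" for j
    proof -
      have "inverse_difference_sum (rotate_config \<theta> z0) j
          = (\<Sum>i\<in>- {j}. 1 / (cis \<theta> * complex_of_real r) * (1 / (e j - e i)))"
        unfolding inverse_difference_sum_def
        by (intro sum.cong refl) (simp add: z0 right_diff_distrib[symmetric] mult.assoc[symmetric])
      also have "\<dots> = 1 / (cis \<theta> * complex_of_real r) * (\<Sum>i\<in>- {j}. 1 / (e j - e i))"
        by (simp only: sum_distrib_left)
      also have "(\<Sum>i\<in>- {j}. 1 / (e j - e i)) = (\<Sum>y\<in>roots7 - {e j}. 1 / (e j - y))"
        by (rule sum.reindex_bij_betw) (use e in \<open>auto simp: bij_betw_def inj_on_def\<close>)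
      also have "\<dots> = 3 / e j" by (rule sum_inverse_difference_roots7[OF e_roots])
      finally show ?thesis by simp
    qed
    have "cnj (inverse_difference_sum (rotate_config \<theta> z0) j) = 3 * cis \<theta> * e j / complex_of_real r" for j
      unfolding S using cnj_roots7[OF e_roots[of j]] e_nz[of j] r by (simp add: cis_cnj cis_inverse[symmetric] divide_simps mult.commute)
    then show ?thesis
      using r by (simp add: vec_eq_iff velocity_def z0 \<Omega>_def field_simps power2_eq_square)
  qed
  have conf: "rotate_config \<theta> z0 \<in> configurations" for \<theta>
    using r e by (auto simp: configurations_def z0 bij_betw_def inj_eq)
  have "integral_curve \<kappa> UNIV (\<lambda>t. rotate_config (\<Omega> * t) z0)"
    unfolding integral_curve_iff_velocity[OF \<open>\<kappa> \<noteq> 0\<close>]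
    using conf velocity has_vector_derivative_rotate_config[of \<Omega> z0] by (simp add: is_interval_univ)
  then have "trajectory \<kappa> UNIV (\<lambda>t. rotate_config (\<Omega> * t) z0)"
    by (auto simp: trajectory_def)
  then show ?thesis
    by (auto simp: relative_equilibrium_def intro!: exI[of _ \<Omega>])
qed

theorem corollary7:
  fixes \<kappa> r\<^sub>0 :: real and z :: "complex ^ 7"
  assumes "\<kappa> \<noteq> 0" and "r\<^sub>0 > 0" and "regular_heptagon r\<^sub>0 z"
  shows "\<exists>\<gamma>. relative_equilibrium \<kappa> \<gamma> \<and> \<gamma> 0 = z \<and> stable_modulo_rotations \<kappa> \<gamma>"
proof -
  obtain e where e: "bij_betw e UNIV roots7" and z: "\<And>j. z $ j = complex_of_real r\<^sub>0 * e j"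
    using regular_heptagon_vertices[OF assms(2,3)] by blast
  define \<Omega> where "\<Omega> = 3 * \<kappa> / (4 * pi * r\<^sub>0\<^sup>2)"
  define \<gamma> where "\<gamma> t = rotate_config (\<Omega> * t) z" for t
  have "z \<in> configurations"
    using \<open>r\<^sub>0 > 0\<close> e by (auto simp: configurations_def z bij_betw_def inj_eq)
  have "relative_equilibrium \<kappa> \<gamma>"
    unfolding \<gamma>_def[abs_def] \<Omega>_def by (rule heptagon_relative_equilibrium[OF assms(1,2) e z])
  moreover have "\<gamma> 0 = z" by (simp add: \<gamma>_def)
  moreover have "stable_modulo_rotations \<kappa> \<gamma>"
  proof (rule strict_local_max_imp_stable[where \<gamma> = \<gamma>, OF \<open>\<kappa> \<noteq> 0\<close> \<open>z \<in> configurations\<close>])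
    show "\<gamma> 0 = z" by fact
    show "\<exists>\<theta>. \<gamma> t = rotate_config \<theta> z" for t by (auto simp: \<gamma>_def)
    show "r\<^sub>0 / 10 ^ 9 > 0" using \<open>r\<^sub>0 > 0\<close> by simp
    show "augmented_energy (3 / r\<^sub>0\<^sup>2) w < augmented_energy (3 / r\<^sub>0\<^sup>2) z"
      if "norm (w - z) \<le> r\<^sub>0 / 10 ^ 9" "Im (hermitian z w) = 0" "w \<noteq> z" for w
      using heptagon_strict_local_max[OF \<open>r\<^sub>0 > 0\<close> e z that] .
  qed
  ultimately show ?thesis by blast
qed

end
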